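(* Let $\{X_{k,n},\ 1\le k\le k(n)\}_{n\ge1}$ be an array of real-valued square integrable random variables (not necessarily centered), with $k(n)\to+\infty$, such that for each $n$ the variables $X_{1,n},\dots,X_{k(n),n}$ are independent, and put $S_n=\sum_{k=1}^{k(n)}X_{k,n}$. Suppose the BVH and the UAN condition hold. Let $a_{k,n}=\mathbb E X_{k,n}$, $a_n=\sum_{k=1}^{k(n)}a_{k,n}$, let $F^*_{k,n}$ be the cumulative distribution function of $X_{k,n}-a_{k,n}$, and let $$K_n^*(x)=\int_{-\infty}^{x}y^2\sum_{k=1}^{k(n)}dF^*_{k,n}(y),\qquad x\in\mathbb R .$$ (i) If $K^*$ is a distribution function with $K_n^*\rightsquigarrow_{pre}K^*$ and $a_n\to a\in\mathbb R$, then $S_n\rightsquigarrow\mathcal K_{K^*}+a$. (ii) If $S_n\rightsquigarrow\mathcal K_0$, where $\mathcal K_0$ is the law of an almost surely finite random variable $Z$, then the sequence $(a_n)_{n\ge1}$ converges to a real number $a$, and there is a distribution function $K^*$ such that $\mathcal K_0=_d\mathcal K_{K^*}+a$ and $K_n^*\rightsquigarrow_{pre}K^*$. Moreover, if the VCH holds in place of the BVH and the variance of $\mathcal K_{K^*}$ is equal to the limit $c$ in the VCH, then $K_n^*\rightsquigarrow K^*$ in both parts (i) and (ii).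
   Context: BVH (Bounded Variance Hypothesis): $\sup_{n\ge1}\sum_{k=1}^{k(n)}\mathrm{Var}(X_{k,n})<+\infty$. VCH (Variance Convergence Hypothesis): $\sum_{k=1}^{k(n)}\mathrm{Var}(X_{k,n})\to c$ for some $c\in]0,+\infty[$. UAN (Uniform Asymptotic Negligibility): for every $\varepsilon>0$, $\sup_{1\le k\le k(n)}\mathbb P(|X_{k,n}|\ge\varepsilon)\to0$ as $n\to+\infty$. A distribution function (df) $K$ here is a bounded nondecreasing right-continuous function on $\mathbb R$; $\lambda_K$ is the associated finite Lebesgue–Stieltjes measure, $\lambda_K(]a,b])=K(b)-K(a)$, and integrals $dK$ are with respect to $\lambda_K$. Pre-weak convergence $K_n\rightsquigarrow_{pre}K$ means: $K_n(x)\to K(x)$ as $n\to+\infty$ for every continuity point $x$ of $K$. Weak convergence $K_n\rightsquigarrow K$ of dfs means: $K_n\rightsquigarrow_{pre}K$ together with $\lambda_{K_n}(\mathbb R)\to\lambda_K(\mathbb R)$. For random variables and laws, $\rightsquigarrow$ is convergence in distribution and $=_d$ is equality in law. For a df $K$, $\mathcal K_K$ is the probability law with characteristic function $\exp(\Psi_K)$, where $\Psi_K(u)=\int\frac{e^{iux}-1-iux}{x^2}\,dK(x)$, $u\in\mathbb R$, the integrand being taken as $-u^2/2$ at $x=0$. $\mathcal K+a$ denotes the law of $Y+a$ when $Y$ has law $\mathcal K$.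
   Formalization: In (ii), since variance may escape to minus infinity in an oscillating way, K_n^* converges pre-weakly to K^* only after subtracting constants b_n; K_n^* itself converges pre-weakly to K^* if K_n^*(x) converges at one continuity point x of K^*. *)

theory Defs
  imports "HOL-Probability.Probability"
begin

section \<open>Bounded distribution functions and the Kolmogorov representation\<close>

text \<open>
  No normalisation at minus infinity is imposed. The measure associated with a distribution
  function \<open>K\<close> is \<open>interval_measure K\<close>, and pre-weak convergence of \<open>Ks n\<close> to \<open>K\<close>, that is
  pointwise convergence at the continuity points of \<open>K\<close>, is \<open>weak_conv Ks K\<close>.
\<close>

definition bounded_df :: "(real \<Rightarrow> real) \<Rightarrow> bool" where
  "bounded_df K \<longleftrightarrow> mono K \<and> (\<forall>x. continuous (at_right x) K) \<and> bounded (range K)"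

definition df_weak_conv :: "(nat \<Rightarrow> real \<Rightarrow> real) \<Rightarrow> (real \<Rightarrow> real) \<Rightarrow> bool" where
  "df_weak_conv Ks K \<longleftrightarrow> weak_conv Ks K \<and>
     (\<lambda>n. measure (interval_measure (Ks n)) UNIV) \<longlonglongrightarrow> measure (interval_measure K) UNIV"

definition kolmogorov_exponent :: "(real \<Rightarrow> real) \<Rightarrow> real \<Rightarrow> complex" where
  "kolmogorov_exponent K u =
     (LINT x|interval_measure K.
        (if x = 0 then - (complex_of_real u)\<^sup>2 / 2
         else (iexp (u * x) - 1 - \<i> * complex_of_real (u * x)) / (complex_of_real x)\<^sup>2))"

definition kolmogorov_law :: "(real \<Rightarrow> real) \<Rightarrow> real measure" where
  "kolmogorov_law K =
     (THE N. real_distribution N \<and> char N = (\<lambda>u. exp (kolmogorov_exponent K u)))"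

definition shift_law :: "real measure \<Rightarrow> real \<Rightarrow> real measure" where
  "shift_law N a = distr N borel (\<lambda>y. y + a)"


section \<open>Triangular arrays\<close>

text \<open>
  Row \<open>n\<close> of the array lives on its own probability space \<open>M n\<close> and consists of
  \<open>X k n\<close> for \<open>1 \<le> k \<le> kn n\<close>. Rows are indexed by \<open>n \<ge> 1\<close>; row \<open>0\<close> is meaningless.
\<close>

definition independent_array ::
    "(nat \<Rightarrow> 'a measure) \<Rightarrow> (nat \<Rightarrow> nat \<Rightarrow> 'a \<Rightarrow> real) \<Rightarrow> (nat \<Rightarrow> nat) \<Rightarrow> bool" where
  "independent_array M X kn \<longleftrightarrow> (\<forall>n\<ge>1. prob_space (M n) \<and>
     (\<forall>k\<in>{1..kn n}. X k n \<in> borel_measurable (M n) \<and> integrable (M n) (\<lambda>\<omega>. (X k n \<omega>)\<^sup>2)) \<and>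
     prob_space.indep_vars (M n) (\<lambda>_. borel) (\<lambda>k. X k n) {1..kn n})"

definition row_variance ::
    "(nat \<Rightarrow> 'a measure) \<Rightarrow> (nat \<Rightarrow> nat \<Rightarrow> 'a \<Rightarrow> real) \<Rightarrow> (nat \<Rightarrow> nat) \<Rightarrow> nat \<Rightarrow> real" where
  "row_variance M X kn n = (\<Sum>k=1..kn n. prob_space.variance (M n) (X k n))"

definition BVH ::
    "(nat \<Rightarrow> 'a measure) \<Rightarrow> (nat \<Rightarrow> nat \<Rightarrow> 'a \<Rightarrow> real) \<Rightarrow> (nat \<Rightarrow> nat) \<Rightarrow> bool" where
  "BVH M X kn \<longleftrightarrow> bdd_above (row_variance M X kn ` {1..})"

definition VCH ::
    "(nat \<Rightarrow> 'a measure) \<Rightarrow> (nat \<Rightarrow> nat \<Rightarrow> 'a \<Rightarrow> real) \<Rightarrow> (nat \<Rightarrow> nat) \<Rightarrow> real \<Rightarrow> bool" where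
  "VCH M X kn c \<longleftrightarrow> 0 < c \<and> row_variance M X kn \<longlonglongrightarrow> c"

definition UAN ::
    "(nat \<Rightarrow> 'a measure) \<Rightarrow> (nat \<Rightarrow> nat \<Rightarrow> 'a \<Rightarrow> real) \<Rightarrow> (nat \<Rightarrow> nat) \<Rightarrow> bool" where
  "UAN M X kn \<longleftrightarrow> (\<forall>\<epsilon>>0.
     (\<lambda>n. SUP k\<in>{1..kn n}. measure (M n) {\<omega> \<in> space (M n). \<epsilon> \<le> \<bar>X k n \<omega>\<bar>}) \<longlonglongrightarrow> 0)"

definition row_sum_law ::
    "(nat \<Rightarrow> 'a measure) \<Rightarrow> (nat \<Rightarrow> nat \<Rightarrow> 'a \<Rightarrow> real) \<Rightarrow> (nat \<Rightarrow> nat) \<Rightarrow> nat \<Rightarrow> real measure" where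
  "row_sum_law M X kn n = distr (M n) borel (\<lambda>\<omega>. \<Sum>k=1..kn n. X k n \<omega>)"

definition row_mean ::
    "(nat \<Rightarrow> 'a measure) \<Rightarrow> (nat \<Rightarrow> nat \<Rightarrow> 'a \<Rightarrow> real) \<Rightarrow> (nat \<Rightarrow> nat) \<Rightarrow> nat \<Rightarrow> real" where
  "row_mean M X kn n = (\<Sum>k=1..kn n. prob_space.expectation (M n) (X k n))"

definition centered_cdf ::
    "(nat \<Rightarrow> 'a measure) \<Rightarrow> (nat \<Rightarrow> nat \<Rightarrow> 'a \<Rightarrow> real) \<Rightarrow> nat \<Rightarrow> nat \<Rightarrow> real \<Rightarrow> real" where
  "centered_cdf M X k n =
     cdf (distr (M n) borel (\<lambda>\<omega>. X k n \<omega> - prob_space.expectation (M n) (X k n)))"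

definition row_df ::
    "(nat \<Rightarrow> 'a measure) \<Rightarrow> (nat \<Rightarrow> nat \<Rightarrow> 'a \<Rightarrow> real) \<Rightarrow> (nat \<Rightarrow> nat) \<Rightarrow> nat \<Rightarrow> real \<Rightarrow> real" where
  "row_df M X kn n x =
     (\<Sum>k=1..kn n. LINT y:{..x}|interval_measure (centered_cdf M X k n). y\<^sup>2)"

text \<open>
  A pitfall for the converse direction: bounded variances alone do not make \<open>row_df M X kn\<close>
  converge pre-weakly when the row sums converge in law. Let \<open>kn n = n\<close>, let \<open>X 1 n\<close> take the
  value \<open>(-1)^n * n\<close> with probability \<open>1 / n^2\<close> and \<open>0\<close> otherwise, and let \<open>X k n = 0\<close>
  for \<open>k \<ge> 2\<close>. The variances, the negligibility condition and independence are fine, the row sums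
  tend to \<open>0\<close> in law and the row means tend to \<open>0\<close>, but for every \<open>x\<close> the numbers
  \<open>row_df M X kn n x\<close> tend to \<open>0\<close> along even \<open>n\<close> and to \<open>1\<close> along odd \<open>n\<close>: variance may
  escape to minus infinity in an oscillating way. What always holds is pre-weak convergence up to
  additive constants, which leave the associated measures unchanged, and the constants are
  superfluous as soon as \<open>row_df M X kn n x\<close> converges at a single continuity point \<open>x\<close> of the
  limit, in particular if no variance is lost in the limit.
\<close>

end

theory Submission
  imports Defs
begin

text \<open>
The idea is to compare the law of a row sum with an infinitely divisible law that has the same
second moment data, and to do so before any limit is taken.

Write \<open>\<phi> k\<close> for the characteristic function of the centred variable \<open>X k n\<close>, at a fixed point \<open>u\<close>.
Negligibility makes all \<open>\<phi> k - 1\<close> uniformly small, while the bound \<open>\<bar>\<phi> k - 1\<bar> \<le> u\<^sup>2 / 2 * variance\<close>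
makes their sum bounded. Hence the product of the \<open>\<phi> k\<close> differs from the product of the
\<open>exp (\<phi> k - 1)\<close> by a sum of squares that tends to \<open>0\<close>. Since the variables are centred,
\<open>\<phi> k - 1\<close> is the expectation of \<open>iexp (u * Y) - 1 - \<i> * u * Y\<close>, that is, of \<open>Y\<^sup>2\<close> times the
Kolmogorov kernel. Summing over the row gives exactly the Kolmogorov exponent of \<open>row_df M X kn n\<close>.
So the characteristic function of the row sum is asymptotically
\<open>exp (\<i> * u * row_mean + kolmogorov_exponent (row_df n) u)\<close>; this is
\<open>row_sum_char_asymptotics\<close>.

The rest concerns sequences of laws with such asymptotics (locale \<open>kolmogorov_approximation\<close>).
The kernel is continuous and vanishes at infinity, so the exponents converge when the distribution
functions converge pre-weakly with bounded masses, even if mass escapes to infinity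
(\<open>weak_conv_kolmogorov_exponent\<close>). Bounded variances give tightness by Chebyshev's inequality, so
the limit of the characteristic functions is itself a characteristic function; this proves the
direct part and at the same time that the Kolmogorov law exists.

For the converse part, Helly's theorem produces subsequences along which the distribution functions
and the means converge, and every such subsequential limit represents the same law. The
representation determines the drift and the measure (\<open>kolmogorov_representation_unique\<close>): the drift
is the derivative of the exponent at \<open>0\<close>, and the second derivative of the exponent is minus the
Fourier transform of the measure. Consequently the means converge, and the distribution functions
converge up to additive constants. A convergent value at one continuity point fixes the constant;
so does the absence of mass loss, which is what the equality of the limit variance
with \<open>c\<close> expresses, because the variance of a Kolmogorov law is the total mass of its measure
(\<open>measure_eq_variance_kolmogorov_law\<close>).
\<close>

section \<open>Bounded distribution functions\<close>

lemma LIMSEQ_if_subsubsequences: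
  fixes f :: "nat \<Rightarrow> 'b::metric_space"
  assumes "\<And>s. strict_mono (s :: nat \<Rightarrow> nat) \<Longrightarrow> \<exists>r. strict_mono (r :: nat \<Rightarrow> nat) \<and> (\<lambda>n. f (s (r n))) \<longlonglongrightarrow> l"
  shows "f \<longlonglongrightarrow> l"
proof (rule ccontr)
  assume "\<not> f \<longlonglongrightarrow> l"
  then obtain \<epsilon> where "\<epsilon> > 0" and inf: "infinite {n. \<not> dist (f n) l < \<epsilon>}"
    by (auto simp: tendsto_iff not_eventually INFM_iff_infinite cofinite_eq_sequentially[symmetric])
  obtain s :: "nat \<Rightarrow> nat" where s: "strict_mono s" "\<And>n. \<not> dist (f (s n)) l < \<epsilon>"
    using infinite_enumerate[OF inf] by blast
  obtain r :: "nat \<Rightarrow> nat" where "(\<lambda>n. f (s (r n))) \<longlonglongrightarrow> l"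
    using assms[OF s(1)] by blast
  then show False
    using tendstoD[OF _ \<open>\<epsilon> > 0\<close>] s(2) by (fastforce dest: eventually_happens)
qed

text \<open>
Distribution functions are not normalised at minus infinity. The measure only sees increments, so
subtracting that limit normalises them without changing the measure.
\<close>

lemma interval_measure_diff_const: "interval_measure (\<lambda>x. K x - l) = interval_measure K"
  by (simp add: interval_measure_def)

lemma bounded_df_lim_at_bot:
  assumes "bounded_df K"
  obtains l where "(K \<longlongrightarrow> l) at_bot" "\<And>x. l \<le> K x"
proof -
  have mono: "mono K" and bdd: "bdd_below (range K)"
    using assms by (auto simp: bounded_df_def bounded_imp_bdd_below)
  have le: "Inf (range K) \<le> K x" for x
    using bdd by (simp add: cINF_lower)
  have "(K \<longlongrightarrow> Inf (range K)) at_bot"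
  proof (rule order_tendstoI)
    fix a assume "a < Inf (range K)"
    then show "\<forall>\<^sub>F x in at_bot. a < K x"
      by (intro always_eventually) (meson le less_le_trans)
  next
    fix a assume "Inf (range K) < a"
    then obtain y where "K y < a"
      using cInf_lessD[of "range K" a] by auto
    then show "\<forall>\<^sub>F x in at_bot. K x < a"
      unfolding eventually_at_bot_linorder by (meson monoD[OF mono] le_less_trans)
  qed
  then show ?thesis using that le by blast
qed

lemma bounded_df_lim_at_top:
  assumes "bounded_df K"
  obtains m where "(K \<longlongrightarrow> m) at_top" "\<And>x. K x \<le> m"
proof -
  have mono: "mono K" and bdd: "bdd_above (range K)"
    using assms by (auto simp: bounded_df_def bounded_imp_bdd_above)
  have le: "K x \<le> Sup (range K)" for x
    using bdd by (simp add: cSUP_upper)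
  have "(K \<longlongrightarrow> Sup (range K)) at_top"
  proof (rule order_tendstoI)
    fix a assume "Sup (range K) < a"
    then show "\<forall>\<^sub>F x in at_top. K x < a"
      by (intro always_eventually) (meson le le_less_trans)
  next
    fix a assume "a < Sup (range K)"
    then obtain y where "a < K y"
      using less_cSupD[of "range K" a] by auto
    then show "\<forall>\<^sub>F x in at_top. a < K x"
      unfolding eventually_at_top_linorder by (meson monoD[OF mono] less_le_trans)
  qed
  then show ?thesis using that le by blast
qed

lemma bounded_df_measure:
  assumes K: "bounded_df K" and l: "(K \<longlongrightarrow> l) at_bot"
  shows bounded_df_finite_borel: "finite_borel_measure (interval_measure K)"
    and cdf_interval_measure_bounded_df: "cdf (interval_measure K) = (\<lambda>x. K x - l)"
    and "\<And>m. (K \<longlongrightarrow> m) at_top \<Longrightarrow> measure (interval_measure K) UNIV = m - l"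
proof -
  obtain m where m: "(K \<longlongrightarrow> m) at_top" "\<And>x. K x \<le> m"
    using bounded_df_lim_at_top[OF K] by blast
  obtain l' where "(K \<longlongrightarrow> l') at_bot" "\<And>x. l' \<le> K x"
    using bounded_df_lim_at_bot[OF K] by blast
  then have ll: "\<And>x. l \<le> K x"
    using tendsto_unique[OF _ l] by auto
  then have lm: "l \<le> m" using m(2) order_trans by blast
  let ?F = "\<lambda>x. K x - l"
  have F: "\<And>x y. x \<le> y \<Longrightarrow> ?F x \<le> ?F y" "\<And>a. continuous (at_right a) ?F"
    "(?F \<longlongrightarrow> 0) at_bot" "(?F \<longlongrightarrow> m - l) at_top"
    using K l m(1)
    by (auto simp: bounded_df_def monoD intro!: continuous_intros tendsto_eq_intros)
  show "finite_borel_measure (interval_measure K)"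
    using finite_borel_measure_interval_measure[OF F] lm
    by (simp add: interval_measure_diff_const)
  show "cdf (interval_measure K) = ?F"
    using cdf_interval_measure[OF F(1-3)] by (simp add: interval_measure_diff_const)
  fix m' assume "(K \<longlongrightarrow> m') at_top"
  then have "m' = m" using m(1) tendsto_unique[OF trivial_limit_at_top_linorder] by blast
  then show "measure (interval_measure K) UNIV = m' - l"
    using interval_measure_UNIV[OF F] lm
    by (simp add: interval_measure_diff_const measure_def)
qed

lemma finite_borel_measure_bounded_df: "bounded_df K \<Longrightarrow> finite_borel_measure (interval_measure K)"
  using bounded_df_finite_borel bounded_df_lim_at_bot by metis

lemma measure_interval_measure_bounded_df:
  assumes "bounded_df K" "a \<le> b"
  shows "measure (interval_measure K) {a<..b} = K b - K a"
  using assms by (auto simp: bounded_df_def monoD intro!: measure_interval_measure_Ioc)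

lemma bounded_df_cdf:
  assumes "finite_borel_measure N"
  shows "bounded_df (cdf N)" "interval_measure (cdf N) = N"
proof -
  interpret finite_borel_measure N by fact
  have "\<bar>cdf N x\<bar> \<le> measure N (space N)" for x
    using cdf_nonneg[of x] cdf_bounded[of x] by simp
  then show *: "bounded_df (cdf N)"
    unfolding bounded_df_def bounded_iff
    by (auto simp: mono_def cdf_nondecreasing cdf_is_right_cont)
  show "interval_measure (cdf N) = N"
    using bounded_df_measure(1,2)[OF * cdf_lim_at_bot]
    by (intro cdf_unique') (auto simp: finite_borel_measure_axioms)
qed

lemma interval_measure_eqD:
  assumes "bounded_df K" "bounded_df L" "interval_measure K = interval_measure L"
  shows "K x - K y = L x - L y"
proof (cases "x \<le> y")
  case True then show ?thesis
    using measure_interval_measure_bounded_df[of K x y] measure_interval_measure_bounded_df[of L x y] assms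
    by simp
next
  case False then show ?thesis
    using measure_interval_measure_bounded_df[of K y x] measure_interval_measure_bounded_df[of L y x] assms
    by simp
qed

lemma ex_isCont_mono:
  fixes K :: "real \<Rightarrow> real"
  assumes "mono K" "a < b"
  obtains x where "a < x" "x < b" "isCont K x"
  using open_minus_countable[OF mono_ctble_discont[OF assms(1)], of "{a<..<b}"] assms(2)
  by auto

section \<open>Finite measures are determined by their Fourier transforms\<close>

text \<open>
The zero measure is determined by its mass, the value of the transform at \<open>0\<close>. Any other measure
is normalised to a probability law, to which Levy's uniqueness theorem applies.
\<close>

lemma char_unique_finite_borel_measure:
  assumes M: "finite_borel_measure M" and N: "finite_borel_measure N"
    and eq: "\<And>u. char M u = char N u"
  shows "M = N"
proof -
  interpret M: finite_borel_measure M by fact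
  interpret N: finite_borel_measure N by fact
  note sM = M.M_is_borel and sN = N.M_is_borel
  define m where "m = measure M UNIV"
  have "measure N UNIV = m"
    using eq[of 0] by (simp add: char_def m_def M.borel_UNIV N.borel_UNIV)
  note mN = this
  show ?thesis
  proof (cases "m = 0")
    case True
    have "emeasure M A = 0" "emeasure N A = 0" for A
      using True mN M.bounded_measure[of A] N.bounded_measure[of A]
      unfolding m_def M.borel_UNIV N.borel_UNIV M.emeasure_eq_measure N.emeasure_eq_measure
      by (simp_all add: antisym)
    then show ?thesis using sM sN by (intro measure_eqI) auto
  next
    case False
    then have m: "m > 0" by (simp add: m_def zero_less_measure_iff)
    let ?n = "\<lambda>M. density M (\<lambda>_. ennreal (1 / m))"
    have dist: "real_distribution (?n L)" if L: "finite_borel_measure L" and "measure L UNIV = m" for L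
    proof -
      interpret L: finite_borel_measure L by fact
      have "emeasure (?n L) (space (?n L)) = 1"
        using that m by (subst emeasure_density_const)
           (auto simp: L.emeasure_eq_measure L.borel_UNIV L.M_is_borel ennreal_mult[symmetric])
      then have "prob_space (?n L)" by (rule prob_spaceI)
      then show ?thesis
        by (simp add: real_distribution_def real_distribution_axioms_def L.M_is_borel)
    qed
    have ch: "char (?n L) u = (1 / m) *\<^sub>R char L u" if "finite_borel_measure L" for L u
    proof -
      interpret L: finite_borel_measure L by fact
      note [measurable_cong] = L.M_is_borel
      show ?thesis unfolding char_def using m
        by (subst integral_density) auto
    qed
    have "?n M = ?n N"
      using dist[OF M] dist[OF N] mN
      by (intro Levy_uniqueness) (simp_all add: fun_eq_iff ch M N eq m_def[symmetric])
    then have meas: "emeasure (?n M) A = emeasure (?n N) A" for A by simp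
    show ?thesis
    proof (rule measure_eqI)
      fix A assume "A \<in> sets M"
      then have "ennreal (1 / m) * emeasure M A = ennreal (1 / m) * emeasure N A"
        using meas[of A] sM sN by (simp add: emeasure_density_const)
      then show "emeasure M A = emeasure N A"
        using m by (simp add: ennreal_mult_cancel_left)
    qed (simp add: sM sN)
  qed
qed

section \<open>The Kolmogorov kernel and exponent\<close>

text \<open>
The integrand of the Kolmogorov exponent. Its two arguments also occur in exchanged roles: for fixed
\<open>u = y\<close> and \<open>x = h \<longlonglongrightarrow> 0\<close> the kernel is the second-order Taylor quotient of \<open>iexp (h * y)\<close>.
\<close>

definition kolmogorov_kernel :: "real \<Rightarrow> real \<Rightarrow> complex" where
  "kolmogorov_kernel u x =
     (if x = 0 then - (complex_of_real u)\<^sup>2 / 2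
      else (iexp (u * x) - 1 - \<i> * complex_of_real (u * x)) / (complex_of_real x)\<^sup>2)"

lemma kolmogorov_exponent_kernel:
  "kolmogorov_exponent K u = (LINT x|interval_measure K. kolmogorov_kernel u x)"
  by (simp add: kolmogorov_exponent_def kolmogorov_kernel_def)

lemma iexp_minus_linear_le_square: "cmod (iexp y - 1 - \<i> * complex_of_real y) \<le> y\<^sup>2 / 2"
  using iexp_approx1[of y 1] by (simp add: diff_diff_eq numeral_2_eq_2)

lemma iexp_minus_linear_le_linear: "cmod (iexp y - 1 - \<i> * complex_of_real y) \<le> 2 * \<bar>y\<bar>"
  using iexp_approx2[of y 1] by (simp add: diff_diff_eq)

lemma iexp_minus_quadratic_le_cube:
  "cmod (iexp y - 1 - \<i> * complex_of_real y + (complex_of_real y)\<^sup>2 / 2) \<le> \<bar>y\<bar> ^ 3 / 6"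
  using iexp_approx1[of y 2]
  by (simp add: numeral_2_eq_2 numeral_3_eq_3 fact_numeral algebra_simps power2_eq_square)

lemma kolmogorov_kernel_le_square: "cmod (kolmogorov_kernel u x) \<le> u\<^sup>2 / 2"
proof (cases "x = 0")
  case True
  then show ?thesis by (simp add: kolmogorov_kernel_def norm_divide norm_power)
next
  case False
  then show ?thesis
    using divide_right_mono[OF iexp_minus_linear_le_square[of "u * x"], of "x\<^sup>2"]
    by (simp add: kolmogorov_kernel_def norm_divide norm_power power_mult_distrib)
qed

lemma kolmogorov_kernel_le_inverse:
  assumes "x \<noteq> 0"
  shows "cmod (kolmogorov_kernel u x) \<le> 2 * \<bar>u\<bar> / \<bar>x\<bar>"
proof -
  have "cmod (kolmogorov_kernel u x) \<le> 2 * \<bar>u * x\<bar> / x\<^sup>2"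
    using divide_right_mono[OF iexp_minus_linear_le_linear[of "u * x"], of "x\<^sup>2"] assms
    by (simp add: kolmogorov_kernel_def norm_divide norm_power)
  also have "\<dots> = 2 * \<bar>u\<bar> / \<bar>x\<bar>"
    using assms unfolding power2_abs[symmetric, of x]
    by (simp add: abs_mult power2_eq_square del: abs_mult_self_eq)
  finally show ?thesis .
qed

lemma kolmogorov_kernel_tendsto_0_at_infinity:
  "(kolmogorov_kernel u \<longlongrightarrow> 0) at_infinity"
proof (rule Lim_null_comparison)
  show "\<forall>\<^sub>F x in at_infinity. cmod (kolmogorov_kernel u x) \<le> 2 * \<bar>u\<bar> / norm x"
    unfolding eventually_at_infinity
    by (intro exI[of _ 1]) (auto intro!: kolmogorov_kernel_le_inverse)
  show "((\<lambda>x::real. 2 * \<bar>u\<bar> / norm x) \<longlongrightarrow> 0) at_infinity"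
    by (intro real_tendsto_divide_at_top[OF tendsto_const] filterlim_norm_at_top)
qed

lemma isCont_kolmogorov_kernel: "isCont (kolmogorov_kernel u) x"
proof (cases "x = 0")
  case True
  have "((\<lambda>y. kolmogorov_kernel u y - kolmogorov_kernel u 0) \<longlongrightarrow> 0) (at 0)"
  proof (rule Lim_null_comparison[OF always_eventually[OF allI]])
    fix y
    show "cmod (kolmogorov_kernel u y - kolmogorov_kernel u 0) \<le> \<bar>u\<bar> ^ 3 * \<bar>y\<bar> / 6"
    proof (cases "y = 0")
      case False
      then have "kolmogorov_kernel u y - kolmogorov_kernel u 0 =
          (iexp (u * y) - 1 - \<i> * complex_of_real (u * y) + (complex_of_real (u * y))\<^sup>2 / 2) / (complex_of_real y)\<^sup>2"
        by (simp add: kolmogorov_kernel_def field_simps)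
      also have "cmod \<dots> \<le> (\<bar>u * y\<bar> ^ 3 / 6) / y\<^sup>2"
        using divide_right_mono[OF iexp_minus_quadratic_le_cube[of "u * y"], of "y\<^sup>2"]
        by (simp only: norm_divide norm_power norm_of_real power2_abs zero_le_power2)
      also have "\<dots> = \<bar>u\<bar> ^ 3 * \<bar>y\<bar> / 6"
        using False unfolding power2_abs[symmetric, of y]
        by (simp add: abs_mult power_mult_distrib power2_eq_square power3_eq_cube del: abs_mult_self_eq)
      finally show ?thesis .
    qed simp
    show "((\<lambda>y. \<bar>u\<bar> ^ 3 * \<bar>y\<bar> / 6) \<longlongrightarrow> 0) (at (0::real))"
      by (auto intro!: tendsto_eq_intros)
  qed
  then show ?thesis
    using True by (simp add: isCont_def Lim_null[symmetric])
next
  case False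
  let ?q = "\<lambda>x. (iexp (u * x) - 1 - \<i> * complex_of_real (u * x)) / (complex_of_real x)\<^sup>2"
  have "\<forall>\<^sub>F y in nhds x. kolmogorov_kernel u y = ?q y"
    using t1_space_nhds[OF False] by (rule eventually_mono) (simp add: kolmogorov_kernel_def)
  moreover have "isCont ?q x"
    using False by (intro continuous_intros) auto
  ultimately show ?thesis
    using isCont_cong by fast
qed

lemma borel_measurable_kolmogorov_kernel [measurable]: "kolmogorov_kernel u \<in> borel_measurable borel"
  by (intro borel_measurable_continuous_onI continuous_at_imp_continuous_on ballI isCont_kolmogorov_kernel)

lemma isCont_kolmogorov_kernel_parameter: "isCont (\<lambda>u. kolmogorov_kernel u x) u"
  by (cases "x = 0") (auto simp: kolmogorov_kernel_def intro!: continuous_intros)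

lemma integrable_kolmogorov_kernel:
  assumes "finite_borel_measure N"
  shows "integrable N (kolmogorov_kernel u)"
proof -
  interpret finite_borel_measure N by fact
  note [measurable_cong] = M_is_borel
  show ?thesis
    by (rule integrable_const_bound[OF AE_I2[OF kolmogorov_kernel_le_square]]) simp
qed

lemma kolmogorov_exponent_le_square:
  assumes "bounded_df K"
  shows "cmod (kolmogorov_exponent K u) \<le> measure (interval_measure K) UNIV * u\<^sup>2 / 2"
proof -
  interpret finite_borel_measure "interval_measure K"
    by (rule finite_borel_measure_bounded_df[OF assms])
  have "cmod (kolmogorov_exponent K u) \<le> (LINT x|interval_measure K. u\<^sup>2 / 2)"
    unfolding kolmogorov_exponent_kernel
    by (intro order_trans[OF integral_norm_bound integral_mono] integrable_norm
          integrable_kolmogorov_kernel finite_borel_measure_axioms kolmogorov_kernel_le_square) simp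
  then show ?thesis by simp
qed

lemma kolmogorov_exponent_0: "bounded_df K \<Longrightarrow> kolmogorov_exponent K 0 = 0"
  using kolmogorov_exponent_le_square[of K 0] by simp

lemma isCont_kolmogorov_exponent:
  assumes "bounded_df K"
  shows "isCont (kolmogorov_exponent K) u"
  unfolding continuous_at_sequentially
proof safe
  interpret finite_borel_measure "interval_measure K"
    by (rule finite_borel_measure_bounded_df[OF assms])
  fix U assume U: "U \<longlonglongrightarrow> u"
  then have "Bseq U" by (rule convergent_imp_Bseq[OF convergentI])
  then obtain c where c: "\<And>n. norm (U n) \<le> c" by (auto simp: Bseq_def)
  show "(kolmogorov_exponent K \<circ> U) \<longlonglongrightarrow> kolmogorov_exponent K u"
    unfolding comp_def kolmogorov_exponent_kernel
  proof (rule integral_dominated_convergence[where w = "\<lambda>_. c\<^sup>2 / 2"])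
    show "AE x in interval_measure K. (\<lambda>n. kolmogorov_kernel (U n) x) \<longlonglongrightarrow> kolmogorov_kernel u x"
      using isCont_tendsto_compose[OF isCont_kolmogorov_kernel_parameter U] by simp
    have "cmod (kolmogorov_kernel (U n) x) \<le> c\<^sup>2 / 2" for n x
      using kolmogorov_kernel_le_square[of "U n" x] power_mono[OF c[of n], of 2] by simp
    then show "\<And>n. AE x in interval_measure K. cmod (kolmogorov_kernel (U n) x) \<le> c\<^sup>2 / 2"
      by simp
  qed auto
qed

text \<open>
In the parameter \<open>u\<close> the second difference removes the linear compensator and leaves
\<open>iexp (u * x) * (2 * cos (h * x) - 2) / x\<^sup>2\<close>. Written with \<open>sinc\<close> it covers \<open>x = 0\<close> as well and is
visibly at most \<open>h\<^sup>2\<close> in modulus, which is the domination needed for the limit \<open>h \<longlonglongrightarrow> 0\<close>.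
\<close>

lemma kolmogorov_kernel_second_difference:
  "kolmogorov_kernel (u + h) x + kolmogorov_kernel (u - h) x - 2 * kolmogorov_kernel u x =
     - (complex_of_real h)\<^sup>2 * (iexp (u * x) * complex_of_real ((sinc (h * x / 2))\<^sup>2))"
proof (cases "x = 0 \<or> h = 0")
  case True
  then show ?thesis
    by (auto simp: kolmogorov_kernel_def field_simps power2_eq_square)
next
  case False
  define t where "t = h * x"
  have "iexp t + iexp (- t) - 2 = complex_of_real (2 * cos t - 2)"
    by (simp add: complex_eq_iff Re_exp Im_exp)
  also have "2 * cos t - 2 = - 4 * (sin (t / 2))\<^sup>2"
    using cos_double_sin[of "t / 2"] by simp
  finally have *: "iexp t + iexp (- t) - 2 = - complex_of_real (4 * (sin (t / 2))\<^sup>2)"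
    by simp
  let ?r = "\<lambda>v. iexp (v * x) - 1 - \<i> * complex_of_real (v * x)"
  have "?r (u + h) + ?r (u - h) - 2 * ?r u = iexp (u * x) * (iexp t + iexp (- t) - 2)"
    by (simp add: t_def ring_distribs exp_add exp_diff exp_minus field_simps)
  also have "\<dots> = - (iexp (u * x) * complex_of_real (4 * (sin (t / 2))\<^sup>2))"
    unfolding * by simp
  finally have *: "?r (u + h) + ?r (u - h) - 2 * ?r u = \<dots>" .
  have "kolmogorov_kernel (u + h) x + kolmogorov_kernel (u - h) x - 2 * kolmogorov_kernel u x =
      (?r (u + h) + ?r (u - h) - 2 * ?r u) / (complex_of_real x)\<^sup>2"
    using False unfolding kolmogorov_kernel_def by (simp add: add_divide_distrib diff_divide_distrib)
  also have "\<dots> = - (iexp (u * x) * complex_of_real (4 * (sin (t / 2))\<^sup>2)) / (complex_of_real x)\<^sup>2"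
    unfolding * ..
  also have "\<dots> = - (complex_of_real h)\<^sup>2 * (iexp (u * x) * complex_of_real ((sinc (h * x / 2))\<^sup>2))"
    using False by (simp add: t_def field_simps power2_eq_square)
  finally show ?thesis .
qed

text \<open>
This recovers the measure from the exponent: up to sign, the second derivative of the exponent is
the Fourier transform of the measure.
\<close>

lemma kolmogorov_exponent_second_derivative:
  assumes K: "bounded_df K" and h: "h \<longlonglongrightarrow> 0" "\<And>n. h n \<noteq> 0"
  shows "(\<lambda>n. (kolmogorov_exponent K (u + h n) + kolmogorov_exponent K (u - h n) -
             2 * kolmogorov_exponent K u) / (complex_of_real (h n))\<^sup>2) \<longlonglongrightarrow> - char (interval_measure K) u"
proof -
  interpret finite_borel_measure "interval_measure K"
    by (rule finite_borel_measure_bounded_df[OF K])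
  note int = integrable_kolmogorov_kernel[OF finite_borel_measure_axioms]
  let ?f = "\<lambda>n x. iexp (u * x) * complex_of_real ((sinc (h n * x / 2))\<^sup>2)"
  have eq: "(kolmogorov_exponent K (u + h n) + kolmogorov_exponent K (u - h n) -
      2 * kolmogorov_exponent K u) / (complex_of_real (h n))\<^sup>2 = - (LINT x|interval_measure K. ?f n x)" for n
  proof -
    have "kolmogorov_exponent K (u + h n) + kolmogorov_exponent K (u - h n) - 2 * kolmogorov_exponent K u =
       (LINT x|interval_measure K. kolmogorov_kernel (u + h n) x + kolmogorov_kernel (u - h n) x - 2 * kolmogorov_kernel u x)"
      unfolding kolmogorov_exponent_kernel using int by simp
    also have "\<dots> = - (complex_of_real (h n))\<^sup>2 * (LINT x|interval_measure K. ?f n x)"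
      unfolding kolmogorov_kernel_second_difference by simp
    finally show ?thesis using h(2)[of n] by simp
  qed
  have "(\<lambda>n. LINT x|interval_measure K. ?f n x) \<longlonglongrightarrow> (LINT x|interval_measure K. iexp (u * x))"
  proof (rule integral_dominated_convergence[where w = "\<lambda>_. 1"])
    have "(\<lambda>n. ?f n x) \<longlonglongrightarrow> iexp (u * x)" for x
    proof -
      have "(\<lambda>n. h n * x / 2) \<longlonglongrightarrow> 0" using h(1) by (auto intro!: tendsto_eq_intros)
      from isCont_tendsto_compose[OF isCont_sinc this]
      have "(\<lambda>n. sinc (h n * x / 2)) \<longlonglongrightarrow> 1" by simp
      then have "(\<lambda>n. ?f n x) \<longlonglongrightarrow> iexp (u * x) * complex_of_real (1\<^sup>2)"
        by (intro tendsto_intros)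
      then show ?thesis by simp
    qed
    then show "AE x in interval_measure K. (\<lambda>n. ?f n x) \<longlonglongrightarrow> iexp (u * x)" by simp
    have "(sinc y)\<^sup>2 \<le> 1" for y :: real
      using abs_sin_x_le_abs_x[of y] by (simp add: power_divide abs_le_square_iff)
    then have "cmod (?f n x) \<le> 1" for n x
      by (simp only: norm_mult norm_exp_i_times norm_of_real abs_power2 mult_1)
    then show "\<And>n. AE x in interval_measure K. cmod (?f n x) \<le> 1" by simp
  qed auto
  then show ?thesis
    unfolding eq char_def by (rule tendsto_minus)
qed

lemma kolmogorov_exponent_unique:
  assumes "bounded_df K" "bounded_df L" "\<And>u. kolmogorov_exponent K u = kolmogorov_exponent L u"
  shows "interval_measure K = interval_measure L"
proof (rule char_unique_finite_borel_measure)
  fix u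
  let ?h = "\<lambda>n. inverse (real (Suc n))"
  have h: "?h \<longlonglongrightarrow> 0" "\<And>n. ?h n \<noteq> 0" by (rule LIMSEQ_inverse_real_of_nat) simp
  show "char (interval_measure K) u = char (interval_measure L) u"
    using LIMSEQ_unique[OF kolmogorov_exponent_second_derivative[OF assms(1) h, of u, unfolded assms(3)]
        kolmogorov_exponent_second_derivative[OF assms(2) h, of u]] by simp
qed (use assms finite_borel_measure_bounded_df in auto)

text \<open>
The zeros of \<open>exp z - 1\<close> are at distance more than \<open>1\<close> from each other. A continuous function with
values among them is therefore constant, so two continuous logarithms that agree at one point agree.
\<close>

lemma exp_eq_1_norm_less_1:
  assumes "exp z = (1::complex)" "cmod z < 1"
  shows "z = 0"
proof -
  obtain n :: int where n: "Re z = 0" "Im z = of_int (2 * n) * pi"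
    using assms(1) exp_eq_1 by blast
  have "\<bar>Im z\<bar> < 1" using abs_Im_le_cmod[of z] assms(2) by linarith
  moreover have "1 \<le> \<bar>of_int (2 * n) * pi\<bar>" if "n \<noteq> 0"
  proof -
    have "1 * 1 \<le> \<bar>real_of_int (2 * n)\<bar> * pi"
      using that pi_gt3 by (intro mult_mono) auto
    then show ?thesis by (simp add: abs_mult)
  qed
  ultimately have "n = 0" using n(2) by force
  then show ?thesis using n by (simp add: complex_eq_iff)
qed

text \<open>
The two exponents are continuous logarithms of the same function and vanish at \<open>0\<close>, so they are
equal. The Kolmogorov exponents are quadratically small at \<open>0\<close>, hence the linear terms must agree;
once the drifts are equal, so are the exponents and the measures.
\<close>

lemma kolmogorov_representation_unique:
  assumes K: "bounded_df K" and L: "bounded_df L"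
    and eq: "\<And>u. exp (\<i> * complex_of_real (u * a) + kolmogorov_exponent K u) =
                 exp (\<i> * complex_of_real (u * b) + kolmogorov_exponent L u)"
  shows "a = b" "interval_measure K = interval_measure L"
proof -
  define d where "d u = (\<i> * complex_of_real (u * a) + kolmogorov_exponent K u) -
    (\<i> * complex_of_real (u * b) + kolmogorov_exponent L u)" for u
  have exp_d: "exp (d u) = 1" for u
    unfolding d_def exp_diff using eq[of u] by simp
  have "continuous_on UNIV d"
    unfolding d_def
    by (intro continuous_intros continuous_at_imp_continuous_on ballI
          isCont_kolmogorov_exponent K L)
  moreover have "\<exists>e>0. \<forall>y. y \<in> UNIV \<and> d y \<noteq> d x \<longrightarrow> e \<le> cmod (d y - d x)" for x
    using exp_eq_1_norm_less_1[of "d y - d x" for y] exp_d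
    by (intro exI[of _ 1]) (force simp: exp_diff)
  ultimately have "d constant_on UNIV"
    by (intro continuous_discrete_range_constant) auto
  then have "d u = d 0" for u by (auto simp: constant_on_def)
  moreover have "d 0 = 0" using K L by (simp add: d_def kolmogorov_exponent_0)
  ultimately have d0: "d u = 0" for u by simp
  show "a = b"
  proof (rule ccontr)
    assume "a \<noteq> b"
    define m where "m = measure (interval_measure K) UNIV + measure (interval_measure L) UNIV + 1"
    have m: "m > 0" by (simp add: m_def add_nonneg_pos)
    \<comment> \<open>At this \<open>u\<close> the linear term is twice the quadratic bound \<open>m * u\<^sup>2 / 2\<close>.\<close>
    define u where "u = \<bar>a - b\<bar> / m"
    have u: "u > 0" using m \<open>a \<noteq> b\<close> by (simp add: u_def)
    have "\<i> * complex_of_real (u * (a - b)) = kolmogorov_exponent L u - kolmogorov_exponent K u"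
      using d0[of u] by (simp add: d_def algebra_simps)
    then have "u * \<bar>a - b\<bar> = cmod (kolmogorov_exponent L u - kolmogorov_exponent K u)"
      using u by (metis abs_mult abs_of_pos norm_ii norm_mult norm_of_real mult_1)
    also have "\<dots> \<le> cmod (kolmogorov_exponent L u) + cmod (kolmogorov_exponent K u)"
      by (rule norm_triangle_ineq4)
    also have "\<dots> \<le> (m - 1) * u\<^sup>2 / 2"
      using kolmogorov_exponent_le_square[OF K, of u] kolmogorov_exponent_le_square[OF L, of u]
      by (simp add: m_def algebra_simps)
    also have "\<dots> \<le> m * u\<^sup>2 / 2" using u by simp
    also have "\<dots> = u * \<bar>a - b\<bar> / 2"
      using m by (simp add: u_def power2_eq_square)
    finally show False using u \<open>a \<noteq> b\<close> by simp
  qed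
  then show "interval_measure K = interval_measure L"
    using d0 by (intro kolmogorov_exponent_unique K L) (simp add: d_def)
qed

section \<open>Integrals under pre-weak convergence\<close>

lemma Ioc_chain_cover:
  fixes p :: "nat \<Rightarrow> real"
  assumes "p 0 < x" "x \<le> p N"
  shows "\<exists>j<N. p j < x \<and> x \<le> p (Suc j)"
  using assms
proof (induction N)
  case (Suc N)
  then show ?case
    by (cases "x \<le> p N") (auto simp: less_Suc_eq not_le)
qed simp

text \<open>
A continuous function that vanishes at infinity is a uniform limit of step functions with finitely
many steps. The steps can end at continuity points of \<open>K\<close>, because a monotone function has only
countably many discontinuities; at such points pre-weak convergence gives convergence of the
measure of each step.
\<close>

lemma step_function_approximation:
  fixes g :: "real \<Rightarrow> 'b::real_normed_vector"
  assumes K: "mono (K :: real \<Rightarrow> real)"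
    and cont: "\<And>x. isCont g x" and lim: "(g \<longlongrightarrow> 0) at_infinity" and "\<epsilon> > 0"
  obtains p :: "nat \<Rightarrow> real" and N where "strict_mono p" "\<And>j. isCont K (p j)"
    "\<And>x. norm (g x - (\<Sum>j<N. indicator {p j<..p (Suc j)} x *\<^sub>R g (p j))) \<le> \<epsilon>"
proof -
  obtain A0 where A0: "\<And>x. A0 \<le> norm x \<Longrightarrow> norm (g x) < \<epsilon>"
    using tendstoD[OF lim \<open>\<epsilon> > 0\<close>] by (auto simp: eventually_at_infinity)
  define A where "A = max A0 1"
  have A: "\<And>x. A \<le> \<bar>x\<bar> \<Longrightarrow> norm (g x) \<le> \<epsilon>" "A \<ge> 1"
    using A0 by (auto simp: A_def less_imp_le)
  have "uniformly_continuous_on {-A-2..A+2} g"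
    using cont by (intro compact_uniformly_continuous continuous_at_imp_continuous_on) auto
  then obtain \<delta> where \<delta>: "\<delta> > 0" "\<And>x y. \<lbrakk>x \<in> {-A-2..A+2}; y \<in> {-A-2..A+2}; \<bar>x - y\<bar> < \<delta>\<rbrakk> \<Longrightarrow> norm (g x - g y) < \<epsilon>"
    using \<open>\<epsilon> > 0\<close> unfolding uniformly_continuous_on_def dist_norm real_norm_def by metis
  \<comment> \<open>One grid point is chosen in each cell of width \<open>\<eta>\<close>, so neighbours are less than \<open>2 * \<eta> \<le> \<delta>\<close> apart.\<close>
  define \<eta> where "\<eta> = min \<delta> 1 / 2"
  have \<eta>: "\<eta> > 0" "2 * \<eta> \<le> \<delta>" "2 * \<eta> \<le> 1" using \<delta>(1) by (auto simp: \<eta>_def)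
  have "\<exists>x. - A - 1 + real j * \<eta> < x \<and> x < - A - 1 + (real j + 1) * \<eta> \<and> isCont K x" for j
    using ex_isCont_mono[OF K, of "- A - 1 + real j * \<eta>" "- A - 1 + (real j + 1) * \<eta>"] \<eta>(1)
    by (auto simp: algebra_simps)
  then obtain p where p: "\<And>j. - A - 1 + real j * \<eta> < p j" "\<And>j. p j < - A - 1 + (real j + 1) * \<eta>"
    and contp: "\<And>j. isCont K (p j)" by metis
  have mono: "strict_mono p"
    unfolding strict_mono_Suc_iff
  proof
    fix j show "p j < p (Suc j)"
      using p(2)[of j] p(1)[of "Suc j"] by (simp add: algebra_simps)
  qed
  define N where "N = nat \<lceil>(2 * A + 1) / \<eta>\<rceil>"
  have "(2 * A + 1) / \<eta> \<le> real N" "real N < (2 * A + 1) / \<eta> + 1"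
    unfolding N_def using \<eta>(1) A(2) by (auto simp: ceiling_less_iff less_ceiling_iff) linarith+
  then have N: "2 * A + 1 \<le> real N * \<eta>" "real N * \<eta> < 2 * A + 1 + \<eta>"
    using \<eta>(1) by (auto simp: field_simps)
  have ends: "p 0 < - A" "A < p N" "p N < A + 2" "- A - 1 < p 0"
    using p(2)[of 0] p(1)[of 0] p(1)[of N] p(2)[of N] N \<eta> by (auto simp: algebra_simps)
  have "norm (g x - (\<Sum>j<N. indicator {p j<..p (Suc j)} x *\<^sub>R g (p j))) \<le> \<epsilon>" for x
  proof (cases "p 0 < x \<and> x \<le> p N")
    case True
    then obtain j where j: "j < N" "p j < x" "x \<le> p (Suc j)"
      using Ioc_chain_cover by blast
    have "indicator {p i<..p (Suc i)} x *\<^sub>R g (p i) = (if i = j then g (p j) else 0)" for i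
    proof -
      consider "Suc i \<le> j" | "i = j" | "Suc j \<le> i" by linarith
      then show ?thesis
      proof cases
        case 1
        then have "p (Suc i) \<le> p j" using mono by (simp add: strict_mono_less_eq)
        then show ?thesis using 1 j by auto
      next
        case 3
        then have "p (Suc j) \<le> p i" using mono by (simp add: strict_mono_less_eq)
        then show ?thesis using 3 j by auto
      qed (use j in auto)
    qed
    then have "(\<Sum>i<N. indicator {p i<..p (Suc i)} x *\<^sub>R g (p i)) = g (p j)"
      using j(1) by simp
    moreover have "norm (g x - g (p j)) < \<epsilon>"
    proof (rule \<delta>(2))
      have "p 0 \<le> p j" using mono by (simp add: strict_mono_less_eq)
      then show "x \<in> {-A-2..A+2}" "p j \<in> {-A-2..A+2}" using True j ends by auto
      show "\<bar>x - p j\<bar> < \<delta>"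
        using j(2,3) p(1)[of j] p(2)[of "Suc j"] \<eta>(2) by (simp add: algebra_simps)
    qed
    ultimately show ?thesis by simp
  next
    case False
    have "p 0 \<le> p j" "p (Suc j) \<le> p N" if "j < N" for j
      using mono that by (simp_all add: strict_mono_less_eq)
    then have "(\<Sum>i<N. indicator {p i<..p (Suc i)} x *\<^sub>R g (p i)) = 0"
      using False by (intro sum.neutral) (force simp: indicator_def)
    moreover have "A \<le> \<bar>x\<bar>" using False ends by auto
    ultimately show ?thesis using A(1) by simp
  qed
  then show thesis using that mono contp by blast
qed

lemma integral_step_function_error:
  fixes g :: "real \<Rightarrow> complex"
  assumes K: "bounded_df K" and g: "g \<in> borel_measurable borel" "\<And>x. cmod (g x) \<le> c"
    and p: "strict_mono p"
    and err: "\<And>x. norm (g x - (\<Sum>j<N. indicator {p j<..p (Suc j)} x *\<^sub>R g (p j))) \<le> \<epsilon>"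
  shows "cmod ((LINT x|interval_measure K. g x) - (\<Sum>j<N. (K (p (Suc j)) - K (p j)) *\<^sub>R g (p j)))
    \<le> measure (interval_measure K) UNIV * \<epsilon>"
proof -
  interpret finite_borel_measure "interval_measure K"
    by (rule finite_borel_measure_bounded_df[OF K])
  let ?h = "\<lambda>x. \<Sum>j<N. indicator {p j<..p (Suc j)} x *\<^sub>R g (p j)"
  have int_g: "integrable (interval_measure K) g"
    using g by (intro integrable_const_bound[of _ c]) auto
  have int_i: "integrable (interval_measure K) (\<lambda>x. indicator {p j<..p (Suc j)} x *\<^sub>R g (p j))" for j
    by (intro integrable_scaleR_left) (auto simp: integrable_indicator_iff less_top[symmetric])
  have int_h: "integrable (interval_measure K) ?h"
    by (rule Bochner_Integration.integrable_sum) (rule int_i)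
  have "(LINT x|interval_measure K. ?h x) = (\<Sum>j<N. (K (p (Suc j)) - K (p j)) *\<^sub>R g (p j))"
  proof (subst Bochner_Integration.integral_sum[OF int_i], rule sum.cong[OF refl])
    fix j
    have "p j \<le> p (Suc j)" using p by (simp add: strict_mono_less_eq)
    then show "(LINT x|interval_measure K. indicator {p j<..p (Suc j)} x *\<^sub>R g (p j)) = (K (p (Suc j)) - K (p j)) *\<^sub>R g (p j)"
      using measure_interval_measure_bounded_df[OF K]
      by (subst integral_scaleR_left) (auto simp: integrable_indicator_iff less_top[symmetric])
  qed
  then have "(LINT x|interval_measure K. g x) - (\<Sum>j<N. (K (p (Suc j)) - K (p j)) *\<^sub>R g (p j)) =
      (LINT x|interval_measure K. g x - ?h x)"
    by (simp only: Bochner_Integration.integral_diff[OF int_g int_h])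
  also have "cmod \<dots> \<le> (LINT x|interval_measure K. \<epsilon>)"
    by (rule order_trans[OF integral_norm_bound integral_mono])
       (use err int_g int_h in \<open>simp_all only: integrable_norm Bochner_Integration.integrable_diff integrable_const\<close>)
  finally show ?thesis by simp
qed

text \<open>
Pre-weak convergence tests only bounded intervals, so mass may escape to infinity. The integrals
converge nevertheless because the integrand is small wherever the escaping mass can be.
\<close>

lemma weak_conv_integral_vanishing_at_infinity:
  fixes g :: "real \<Rightarrow> complex"
  assumes Ks: "\<And>n. bounded_df (Ks n)" "\<And>n. measure (interval_measure (Ks n)) UNIV \<le> B"
    and K: "bounded_df K" and conv: "weak_conv Ks K"
    and g: "\<And>x. isCont g x" "\<And>x. cmod (g x) \<le> c" "(g \<longlongrightarrow> 0) at_infinity"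
  shows "(\<lambda>n. LINT x|interval_measure (Ks n). g x) \<longlonglongrightarrow> (LINT x|interval_measure K. g x)"
proof (rule tendstoI)
  fix e :: real assume e: "e > 0"
  define C where "C = max B (measure (interval_measure K) UNIV) + 1"
  have C: "C > 0" "\<And>n. measure (interval_measure (Ks n)) UNIV \<le> C" "measure (interval_measure K) UNIV \<le> C"
  proof -
    have nonneg: "0 \<le> measure (interval_measure K) UNIV" by simp
    show "C > 0" "measure (interval_measure K) UNIV \<le> C"
      using nonneg unfolding C_def by linarith+
    show "measure (interval_measure (Ks n)) UNIV \<le> C" for n
      using Ks(2)[of n] unfolding C_def by linarith
  qed
  define \<epsilon> where "\<epsilon> = e / (3 * C)"
  have \<epsilon>: "\<epsilon> > 0" "C * \<epsilon> = e / 3" using C(1) e by (auto simp: \<epsilon>_def)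
  have mono: "mono K" using K by (simp add: bounded_df_def)
  have meas: "g \<in> borel_measurable borel"
    using g(1) by (intro borel_measurable_continuous_onI continuous_at_imp_continuous_on) auto
  obtain p N where p: "strict_mono p" "\<And>j. isCont K (p j)"
    and err: "\<And>x. norm (g x - (\<Sum>j<N. indicator {p j<..p (Suc j)} x *\<^sub>R g (p j))) \<le> \<epsilon>"
    using step_function_approximation[OF mono g(1,3) \<epsilon>(1)] by blast
  let ?J = "\<lambda>L. \<Sum>j<N. (L (p (Suc j)) - L (p j)) *\<^sub>R g (p j)"
  have close: "cmod ((LINT x|interval_measure L. g x) - ?J L) \<le> e / 3"
    if "bounded_df L" "measure (interval_measure L) UNIV \<le> C" for L
    using integral_step_function_error[OF that(1) meas g(2) p(1) err]
      mult_right_mono[OF that(2) less_imp_le[OF \<epsilon>(1)]] \<epsilon>(2) by linarith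
  have "(\<lambda>n. ?J (Ks n)) \<longlonglongrightarrow> ?J K"
    using conv p(2) unfolding weak_conv_def by (intro tendsto_intros) auto
  then have "\<forall>\<^sub>F n in sequentially. dist (?J (Ks n)) (?J K) < e / 3"
    using e by (intro tendstoD) auto
  then show "\<forall>\<^sub>F n in sequentially.
      dist (LINT x|interval_measure (Ks n). g x) (LINT x|interval_measure K. g x) < e"
  proof eventually_elim
    case (elim n)
    have "dist (LINT x|interval_measure (Ks n). g x) (?J (Ks n)) \<le> e / 3"
      "dist (LINT x|interval_measure K. g x) (?J K) \<le> e / 3"
      using close[OF Ks(1) C(2)] close[OF K C(3)] by (simp_all add: dist_norm)
    then show ?case
      using elim dist_triangle[of "LINT x|interval_measure (Ks n). g x" "LINT x|interval_measure K. g x" "?J (Ks n)"]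
        dist_triangle2[of "?J (Ks n)" "LINT x|interval_measure K. g x" "?J K"] by linarith
  qed
qed

lemma weak_conv_kolmogorov_exponent:
  assumes "\<And>n. bounded_df (Ks n)" "\<And>n. measure (interval_measure (Ks n)) UNIV \<le> B"
    and "bounded_df K" "weak_conv Ks K"
  shows "(\<lambda>n. kolmogorov_exponent (Ks n) u) \<longlonglongrightarrow> kolmogorov_exponent K u"
  unfolding kolmogorov_exponent_kernel
  using assms isCont_kolmogorov_kernel kolmogorov_kernel_le_square kolmogorov_kernel_tendsto_0_at_infinity
  by (rule weak_conv_integral_vanishing_at_infinity)

section \<open>The Kolmogorov law and its variance\<close>

lemma cmod_exp_minus_linear_le:
  fixes z :: complex
  assumes "cmod z \<le> 1"
  shows "cmod (exp z - 1 - z) \<le> 3 * (cmod z)\<^sup>2"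
proof -
  have "cmod (exp z - 1 - z) \<le> exp \<bar>Re z\<bar> * (cmod z)\<^sup>2"
    using Taylor_exp[of z 1] by (simp add: diff_diff_eq power2_eq_square)
  also have "exp \<bar>Re z\<bar> \<le> 3"
    using abs_Re_le_cmod[of z] assms exp_le exp_le_cancel_iff[of "\<bar>Re z\<bar>" 1] by linarith
  finally show ?thesis by (simp add: mult_right_mono)
qed

lemma char_distr_shift:
  assumes "real_distribution N"
  shows "char (distr N borel (\<lambda>y. y + a)) u = iexp (u * a) * char N u"
proof -
  interpret real_distribution N by fact
  show ?thesis
    unfolding char_def by (subst integral_distr) (auto simp: ring_distribs exp_add mult.commute)
qed

lemma shift_law_distr:
  assumes "real_distribution N"
  shows "shift_law (distr N borel (\<lambda>y. y + a)) (- a) = N"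
proof -
  interpret real_distribution N by fact
  show ?thesis
    unfolding shift_law_def by (subst distr_distr) (auto simp: comp_def distr_id2)
qed

lemma kolmogorov_law_eqI:
  assumes "real_distribution N" "\<And>u. char N u = exp (kolmogorov_exponent K u)"
  shows "kolmogorov_law K = N"
  unfolding kolmogorov_law_def
  using assms by (intro the_equality) (auto simp: fun_eq_iff intro!: Levy_uniqueness)

text \<open>
The Kolmogorov law is defined by a definite description, which says nothing unless such a law is
known to exist. Existence is read off from any law whose characteristic function has the right form
up to a drift.
\<close>

lemma shift_kolmogorov_law_eqI:
  assumes N: "real_distribution N"
    and char: "\<And>u. char N u = exp (\<i> * complex_of_real (u * a) + kolmogorov_exponent K u)"
  shows "N = shift_law (kolmogorov_law K) a"
    and "real_distribution (kolmogorov_law K)"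
    and "char (kolmogorov_law K) u = exp (kolmogorov_exponent K u)"
proof -
  interpret real_distribution N by fact
  let ?N = "distr N borel (\<lambda>y. y + - a)"
  have dist: "real_distribution ?N" by simp
  have ch: "char ?N u = exp (kolmogorov_exponent K u)" for u
    unfolding char_distr_shift[OF N] char by (simp add: exp_add exp_minus field_simps)
  have law: "kolmogorov_law K = ?N" using dist ch by (rule kolmogorov_law_eqI)
  show "N = shift_law (kolmogorov_law K) a"
    using shift_law_distr[OF N, of "- a"] law by simp
  show "real_distribution (kolmogorov_law K)" "char (kolmogorov_law K) u = exp (kolmogorov_exponent K u)"
    using dist ch law by simp_all
qed

text \<open>
The left hand side is the expectation of \<open>kolmogorov_kernel y (h n)\<close> over \<open>y\<close>, and this kernel is
dominated by \<open>y\<^sup>2 / 2\<close> and continuous at \<open>h = 0\<close>.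
\<close>

lemma (in real_distribution) char_second_order:
  assumes sq: "integrable M (\<lambda>y. y\<^sup>2)" and h: "h \<longlonglongrightarrow> 0" "\<And>n. h n \<noteq> 0"
  shows "(\<lambda>n. (char M (h n) - 1 - \<i> * complex_of_real (h n * expectation (\<lambda>y. y))) / (complex_of_real (h n))\<^sup>2)
    \<longlonglongrightarrow> - complex_of_real (expectation (\<lambda>y. y\<^sup>2)) / 2"
proof -
  have int1: "integrable M (\<lambda>y. y)"
    using sq by (rule square_integrable_imp_integrable[rotated]) auto
  have int1': "integrable M (\<lambda>y. complex_of_real y)" using int1 by simp
  have inte: "integrable M (\<lambda>y. iexp (t * y))" for t
    by (intro integrable_const_bound[of _ 1]) auto
  have "(char M (h n) - 1 - \<i> * complex_of_real (h n * expectation (\<lambda>y. y))) / (complex_of_real (h n))\<^sup>2 =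
      expectation (\<lambda>y. kolmogorov_kernel y (h n))" for n
  proof -
    have "expectation (\<lambda>y. kolmogorov_kernel y (h n)) =
      expectation (\<lambda>y. iexp (h n * y) - 1 - \<i> * complex_of_real (h n) * complex_of_real y) / (complex_of_real (h n))\<^sup>2"
      using h(2)[of n] by (simp add: kolmogorov_kernel_def mult_ac)
    also have "expectation (\<lambda>y. iexp (h n * y) - 1 - \<i> * complex_of_real (h n) * complex_of_real y) =
      char M (h n) - 1 - \<i> * complex_of_real (h n) * complex_of_real (expectation (\<lambda>y. y))"
      unfolding char_def using inte int1'
      by (subst Bochner_Integration.integral_diff Bochner_Integration.integral_diff;
          simp del: space_eq_univ add: prob_space)+
    finally show ?thesis by simp
  qed
  moreover have "(\<lambda>n. expectation (\<lambda>y. kolmogorov_kernel y (h n))) \<longlonglongrightarrow> expectation (\<lambda>y. kolmogorov_kernel y 0)"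
  proof (rule integral_dominated_convergence[where w = "\<lambda>y. y\<^sup>2 / 2"])
    show "AE y in M. (\<lambda>n. kolmogorov_kernel y (h n)) \<longlonglongrightarrow> kolmogorov_kernel y 0"
      using isCont_tendsto_compose[OF isCont_kolmogorov_kernel h(1)] by simp
    show "\<And>n. AE y in M. cmod (kolmogorov_kernel y (h n)) \<le> y\<^sup>2 / 2"
      by (intro AE_I2 kolmogorov_kernel_le_square)
    show "(\<lambda>y. kolmogorov_kernel y 0) \<in> borel_measurable M"
      "\<And>n. (\<lambda>y. kolmogorov_kernel y (h n)) \<in> borel_measurable M"
      unfolding kolmogorov_kernel_def using h(2) by simp_all
    show "integrable M (\<lambda>y. y\<^sup>2 / 2)" using sq by simp
  qed
  moreover have "expectation (\<lambda>y. kolmogorov_kernel y 0) = - complex_of_real (expectation (\<lambda>y. y\<^sup>2)) / 2"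
  proof -
    have "expectation (\<lambda>y. kolmogorov_kernel y 0) = expectation (\<lambda>y. complex_of_real (- (y\<^sup>2 / 2)))"
      by (simp add: kolmogorov_kernel_def)
    also have "\<dots> = complex_of_real (expectation (\<lambda>y. - (y\<^sup>2 / 2)))"
      by (rule integral_complex_of_real)
    finally show ?thesis by simp
  qed
  ultimately show ?thesis by simp
qed

text \<open>
Positivity of \<open>c\<close> matters: a non-integrable square has the default variance \<open>0\<close>, so a positive
variance certifies that the second moment is finite. The characteristic function then has two
second-order expansions at \<open>0\<close>, one from the moments of the law and one from the exponent.
Comparing the coefficients gives mean \<open>0\<close> and second moment equal to the total mass.
\<close>

lemma measure_eq_variance_kolmogorov_law:
  assumes L: "real_distribution L" and K: "bounded_df K"
    and char: "\<And>u. char L u = exp (kolmogorov_exponent K u)"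
    and var: "prob_space.variance L (\<lambda>y. y) = c" "c > 0"
  shows "measure (interval_measure K) UNIV = c"
proof -
  interpret real_distribution L by fact
  let ?\<mu> = "expectation (\<lambda>y. y)" and ?v = "expectation (\<lambda>y. y\<^sup>2)"
  define m where "m = measure (interval_measure K) UNIV"
  have int2: "integrable L (\<lambda>y. (y - ?\<mu>)\<^sup>2)"
    using var not_integrable_integral_eq by force
  have "integrable L (\<lambda>y. y - ?\<mu>)"
    using int2 by (rule square_integrable_imp_integrable[rotated]) auto
  then have "integrable L (\<lambda>y. (y - ?\<mu>) + ?\<mu>)"
    by (rule Bochner_Integration.integrable_add) simp
  then have int1: "integrable L (\<lambda>y. y)" by simp
  have "integrable L (\<lambda>y. (y - ?\<mu>)\<^sup>2 + 2 * ?\<mu> * y - ?\<mu>\<^sup>2)"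
    using int1 int2 by simp
  then have sq: "integrable L (\<lambda>y. y\<^sup>2)"
    by (simp add: power2_diff algebra_simps)
  define h where "h n = inverse (real (Suc n))" for n
  have h: "h \<longlonglongrightarrow> 0" "\<And>n. h n \<noteq> 0"
    unfolding h_def by (rule LIMSEQ_inverse_real_of_nat) simp
  have hpos: "h n > 0" for n by (simp add: h_def)
  have h': "(\<lambda>n. - h n) \<longlonglongrightarrow> 0" "\<And>n. - h n \<noteq> 0"
    using tendsto_minus[OF h(1)] h(2) by simp_all
  \<comment> \<open>The part of the expansion of \<open>char L = exp \<circ> kolmogorov_exponent K\<close> beyond the linear term of \<open>exp\<close>.\<close>
  let ?q = "\<lambda>t. (char L t - 1 - kolmogorov_exponent K t) / (complex_of_real t)\<^sup>2"
  have q: "(\<lambda>n. ?q (t n)) \<longlonglongrightarrow> 0" if t: "t \<longlonglongrightarrow> 0" "\<And>n. t n \<noteq> 0" for t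
  proof (rule Lim_null_comparison)
    have "(\<lambda>n. m * (t n)\<^sup>2 / 2) \<longlonglongrightarrow> 0"
      using t(1) by (auto intro!: tendsto_eq_intros)
    from order_tendstoD(2)[OF this zero_less_one]
    show "\<forall>\<^sub>F n in sequentially. cmod (?q (t n)) \<le> 3 * m\<^sup>2 / 4 * (t n)\<^sup>2"
    proof eventually_elim
      case (elim n)
      have le: "cmod (kolmogorov_exponent K (t n)) \<le> m * (t n)\<^sup>2 / 2"
        using kolmogorov_exponent_le_square[OF K] by (simp add: m_def)
      then have "cmod (char L (t n) - 1 - kolmogorov_exponent K (t n)) \<le> 3 * (cmod (kolmogorov_exponent K (t n)))\<^sup>2"
        using elim unfolding char by (intro cmod_exp_minus_linear_le) simp
      also have "\<dots> \<le> 3 * (m * (t n)\<^sup>2 / 2)\<^sup>2"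
        using le by (intro mult_left_mono power_mono) auto
      also have "\<dots> = 3 * m\<^sup>2 / 4 * (t n)\<^sup>2 * (t n)\<^sup>2"
        by (simp add: power2_eq_square)
      finally show ?case
        using t(2)[of n] by (simp add: norm_divide norm_power divide_le_eq)
    qed
    show "(\<lambda>n. 3 * m\<^sup>2 / 4 * (t n)\<^sup>2) \<longlonglongrightarrow> 0"
      using t(1) by (auto intro!: tendsto_eq_intros)
  qed
  let ?e = "\<lambda>t. (char L t - 1 - \<i> * complex_of_real (t * ?\<mu>)) / (complex_of_real t)\<^sup>2"
  note e = char_second_order[OF sq]
  \<comment> \<open>Symmetric second differences at \<open>0\<close> cancel the mean and isolate the quadratic coefficients.\<close>
  have "complex_of_real m = complex_of_real ?v"
  proof -
    have "(\<lambda>n. (?e (h n) + ?e (- h n)) - (?q (h n) + ?q (- h n))) \<longlonglongrightarrow>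
       (- complex_of_real ?v / 2 + - complex_of_real ?v / 2) - (0 + 0)"
      by (intro tendsto_diff tendsto_add e q h h')
    moreover have "(?e (h n) + ?e (- h n)) - (?q (h n) + ?q (- h n)) =
        (kolmogorov_exponent K (0 + h n) + kolmogorov_exponent K (0 - h n) - 2 * kolmogorov_exponent K 0) / (complex_of_real (h n))\<^sup>2" for n
      by (simp add: add_divide_distrib diff_divide_distrib kolmogorov_exponent_0[OF K])
    ultimately have "- char (interval_measure K) 0 = - complex_of_real ?v"
      using LIMSEQ_unique[OF kolmogorov_exponent_second_derivative[OF K h, of 0]] by simp
    then show ?thesis by (simp add: char_def m_def scaleR_conv_of_real)
  qed
  then have m: "m = ?v" by simp
  have "?\<mu> = 0"
  proof -
    have lim0: "(\<lambda>n. kolmogorov_exponent K (h n) / complex_of_real (h n)) \<longlonglongrightarrow> 0"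
    proof (rule Lim_null_comparison[OF always_eventually[OF allI]])
      fix n
      have "cmod (kolmogorov_exponent K (h n)) / \<bar>h n\<bar> \<le> (m * (h n)\<^sup>2 / 2) / \<bar>h n\<bar>"
        using kolmogorov_exponent_le_square[OF K] by (intro divide_right_mono) (auto simp: m_def)
      then show "cmod (kolmogorov_exponent K (h n) / complex_of_real (h n)) \<le> m * h n / 2"
        using hpos[of n] by (simp add: norm_divide power2_eq_square)
      show "(\<lambda>n. m * h n / 2) \<longlonglongrightarrow> 0"
        using h(1) by (auto intro!: tendsto_eq_intros)
    qed
    have "(\<lambda>n. complex_of_real (h n) * (?q (h n) - ?e (h n)) + kolmogorov_exponent K (h n) / complex_of_real (h n))
        \<longlonglongrightarrow> complex_of_real 0 * (0 - - complex_of_real ?v / 2) + 0"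
      by (intro tendsto_intros e q h lim0)
    moreover have "complex_of_real (h n) * (?q (h n) - ?e (h n)) + kolmogorov_exponent K (h n) / complex_of_real (h n)
        = \<i> * complex_of_real ?\<mu>" for n
      using h(2)[of n] by (simp add: field_simps power2_eq_square)
    ultimately have "\<i> * complex_of_real ?\<mu> = 0"
      by (simp add: LIMSEQ_const_iff)
    then show ?thesis by simp
  qed
  then show ?thesis
    using variance_eq[OF int1 sq] var(1) m by (simp add: m_def)
qed

section \<open>The second moment measure of a row\<close>

text \<open>
The sum over \<open>k\<close> of the measures \<open>y\<^sup>2 dF k (y)\<close>. The sum is written as integration against counting
measure, so that Fubini's theorem and the rules for densities and image measures compute its
integrals.
\<close>

definition second_moment_measure :: "'a measure \<Rightarrow> ('i \<Rightarrow> 'a \<Rightarrow> real) \<Rightarrow> 'i set \<Rightarrow> real measure" where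
  "second_moment_measure M Y I =
     distr (density (count_space I \<Otimes>\<^sub>M M) (\<lambda>(k, \<omega>). ennreal ((Y k \<omega>)\<^sup>2))) borel (\<lambda>(k, \<omega>). Y k \<omega>)"

context prob_space
begin

context
  fixes Y :: "'i \<Rightarrow> 'a \<Rightarrow> real" and I :: "'i set"
  assumes fin: "finite I" and meas: "\<And>k. k \<in> I \<Longrightarrow> Y k \<in> borel_measurable M"
    and sq: "\<And>k. k \<in> I \<Longrightarrow> integrable M (\<lambda>\<omega>. (Y k \<omega>)\<^sup>2)"
begin

lemma measurable_uncurry_row: "(\<lambda>(k, \<omega>). Y k \<omega>) \<in> borel_measurable (count_space I \<Otimes>\<^sub>M M)"
  using fin meas by (intro measurable_pair_measure_countable1) (auto intro: countable_finite)

lemma integral_uncurry_row: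
  fixes f :: "real \<Rightarrow> 'b::{banach, second_countable_topology}"
  assumes f: "f \<in> borel_measurable borel" "\<And>x. norm (f x) \<le> c"
  shows "integrable (count_space I \<Otimes>\<^sub>M M) (\<lambda>(k, \<omega>). (Y k \<omega>)\<^sup>2 *\<^sub>R f (Y k \<omega>))"
    and "(\<integral>z. (case z of (k, \<omega>) \<Rightarrow> (Y k \<omega>)\<^sup>2 *\<^sub>R f (Y k \<omega>)) \<partial>(count_space I \<Otimes>\<^sub>M M)) =
      (\<Sum>k\<in>I. expectation (\<lambda>\<omega>. (Y k \<omega>)\<^sup>2 *\<^sub>R f (Y k \<omega>)))"
proof -
  interpret C: sigma_finite_measure "count_space I"
    using fin by (rule sigma_finite_measure_count_space_finite)
  interpret P: pair_sigma_finite "count_space I" M ..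
  note [measurable] = f(1) measurable_uncurry_row
  have int: "integrable M (\<lambda>\<omega>. (Y k \<omega>)\<^sup>2 *\<^sub>R f (Y k \<omega>))" if k: "k \<in> I" for k
  proof (rule Bochner_Integration.integrable_bound)
    note [measurable] = meas[OF k]
    show "integrable M (\<lambda>\<omega>. c * (Y k \<omega>)\<^sup>2)" using sq[OF k] by simp
    show "(\<lambda>\<omega>. (Y k \<omega>)\<^sup>2 *\<^sub>R f (Y k \<omega>)) \<in> borel_measurable M" by measurable
    have "norm ((Y k \<omega>)\<^sup>2 *\<^sub>R f (Y k \<omega>)) \<le> norm (c * (Y k \<omega>)\<^sup>2)" for \<omega>
      using mult_right_mono[OF order_trans[OF f(2)[of "Y k \<omega>"] abs_ge_self], of "(Y k \<omega>)\<^sup>2"]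
      by (simp add: abs_mult mult.commute)
    then show "AE \<omega> in M. norm ((Y k \<omega>)\<^sup>2 *\<^sub>R f (Y k \<omega>)) \<le> norm (c * (Y k \<omega>)\<^sup>2)" by simp
  qed
  have "(\<lambda>z. (case z of (k, \<omega>) \<Rightarrow> Y k \<omega>)\<^sup>2 *\<^sub>R f (case z of (k, \<omega>) \<Rightarrow> Y k \<omega>)) \<in>
      borel_measurable (count_space I \<Otimes>\<^sub>M M)"
    by measurable
  then have "(\<lambda>(k, \<omega>). (Y k \<omega>)\<^sup>2 *\<^sub>R f (Y k \<omega>)) \<in> borel_measurable (count_space I \<Otimes>\<^sub>M M)"
    by (simp add: split_beta')
  then show *: "integrable (count_space I \<Otimes>\<^sub>M M) (\<lambda>(k, \<omega>). (Y k \<omega>)\<^sup>2 *\<^sub>R f (Y k \<omega>))"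
    using fin int by (intro P.Fubini_integrable) (auto simp: integrable_count_space AE_count_space)
  show "(\<integral>z. (case z of (k, \<omega>) \<Rightarrow> (Y k \<omega>)\<^sup>2 *\<^sub>R f (Y k \<omega>)) \<partial>(count_space I \<Otimes>\<^sub>M M)) =
      (\<Sum>k\<in>I. expectation (\<lambda>\<omega>. (Y k \<omega>)\<^sup>2 *\<^sub>R f (Y k \<omega>)))"
    using P.integral_fst'[OF *] fin by (simp add: lebesgue_integral_count_space_finite)
qed

lemma finite_borel_measure_second_moment: "finite_borel_measure (second_moment_measure M Y I)"
proof -
  let ?P = "count_space I \<Otimes>\<^sub>M M"
  have "integrable ?P (\<lambda>(k, \<omega>). (Y k \<omega>)\<^sup>2)"
    using integral_uncurry_row(1)[of "\<lambda>_. 1 :: real" 1] by simp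
  then have "(\<integral>\<^sup>+z. (case z of (k, \<omega>) \<Rightarrow> ennreal ((Y k \<omega>)\<^sup>2)) \<partial>?P) < \<infinity>"
    using nn_integral_eq_integral[of ?P "\<lambda>(k, \<omega>). (Y k \<omega>)\<^sup>2"]
    by (simp add: split_beta')
  moreover have meas_sq: "(\<lambda>(k, \<omega>). ennreal ((Y k \<omega>)\<^sup>2)) \<in> borel_measurable ?P"
    using measurable_uncurry_row by (simp add: split_beta')
  have "emeasure (density ?P (\<lambda>(k, \<omega>). ennreal ((Y k \<omega>)\<^sup>2))) (space ?P) =
      (\<integral>\<^sup>+z. (case z of (k, \<omega>) \<Rightarrow> ennreal ((Y k \<omega>)\<^sup>2)) \<partial>?P)"
    unfolding emeasure_density[OF meas_sq sets.top] by (rule nn_integral_cong) simp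
  ultimately have "finite_measure (density ?P (\<lambda>(k, \<omega>). ennreal ((Y k \<omega>)\<^sup>2)))"
    by (intro finite_measureI) simp
  then have "finite_measure (second_moment_measure M Y I)"
    unfolding second_moment_measure_def
    using measurable_uncurry_row by (intro finite_measure.finite_measure_distr) simp_all
  then show ?thesis
    by (simp add: finite_borel_measure_def finite_borel_measure_axioms_def second_moment_measure_def)
qed

lemma integral_second_moment_measure:
  fixes f :: "real \<Rightarrow> 'b::{banach, second_countable_topology}"
  assumes f: "f \<in> borel_measurable borel" "\<And>x. norm (f x) \<le> c"
  shows "(\<integral>x. f x \<partial>second_moment_measure M Y I) = (\<Sum>k\<in>I. expectation (\<lambda>\<omega>. (Y k \<omega>)\<^sup>2 *\<^sub>R f (Y k \<omega>)))"
proof -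
  let ?P = "count_space I \<Otimes>\<^sub>M M"
  note [measurable] = measurable_uncurry_row f(1)
  have eq: "(\<lambda>(k, \<omega>). ennreal ((Y k \<omega>)\<^sup>2)) = (\<lambda>z. ennreal ((case z of (k, \<omega>) \<Rightarrow> Y k \<omega>)\<^sup>2))"
    by (simp add: split_beta')
  have "(\<integral>x. f x \<partial>second_moment_measure M Y I) =
      (\<integral>z. (case z of (k, \<omega>) \<Rightarrow> Y k \<omega>)\<^sup>2 *\<^sub>R f (case z of (k, \<omega>) \<Rightarrow> Y k \<omega>) \<partial>?P)"
    unfolding second_moment_measure_def eq
    by (subst integral_distr, simp, simp, subst integral_density) simp_all
  also have "\<dots> = (\<integral>z. (case z of (k, \<omega>) \<Rightarrow> (Y k \<omega>)\<^sup>2 *\<^sub>R f (Y k \<omega>)) \<partial>?P)"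
    by (simp add: split_beta')
  finally show ?thesis using integral_uncurry_row(2)[OF f] by simp
qed

lemma measure_second_moment_measure:
  assumes A: "A \<in> sets borel"
  shows "measure (second_moment_measure M Y I) A = (\<Sum>k\<in>I. expectation (\<lambda>\<omega>. indicator A (Y k \<omega>) * (Y k \<omega>)\<^sup>2))"
proof -
  interpret S: finite_borel_measure "second_moment_measure M Y I"
    by (rule finite_borel_measure_second_moment)
  have "measure (second_moment_measure M Y I) A = (\<integral>x. indicator A x \<partial>second_moment_measure M Y I)"
    by (simp add: S.borel_UNIV)
  also have "\<dots> = (\<Sum>k\<in>I. expectation (\<lambda>\<omega>. (Y k \<omega>)\<^sup>2 *\<^sub>R indicator A (Y k \<omega>)))"
    using A by (intro integral_second_moment_measure[of _ 1]) (auto simp: indicator_def)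
  finally show ?thesis by (simp add: mult.commute)
qed

lemma cdf_second_moment_measure:
  "cdf (second_moment_measure M Y I) x =
    (\<Sum>k\<in>I. LINT y:{..x}|interval_measure (cdf (distr M borel (Y k))). y\<^sup>2)"
proof -
  have "expectation (\<lambda>\<omega>. indicator {..x} (Y k \<omega>) * (Y k \<omega>)\<^sup>2) =
      (LINT y:{..x}|interval_measure (cdf (distr M borel (Y k))). y\<^sup>2)" if k: "k \<in> I" for k
  proof -
    interpret D: real_distribution "distr M borel (Y k)"
      using meas[OF k] by simp
    show ?thesis
      unfolding bounded_df_cdf(2)[OF D.finite_borel_measure_M] set_lebesgue_integral_def
      using meas[OF k] by (subst integral_distr) auto
  qed
  then show ?thesis
    unfolding cdf_def by (subst measure_second_moment_measure) auto
qed

end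

end

section \<open>Characteristic functions of sums of negligible variables\<close>

context prob_space
begin

text \<open>
A variable that is small with probability at least one half and has a bounded variance has a small
mean: a mean beyond \<open>\<epsilon>\<close> would have to be compensated on the exceptional event, where Young's
inequality with weight \<open>t\<close> limits the contribution of the deviation \<open>X - expectation X\<close>. This
transfers negligibility from the variables to the centred variables.
\<close>

lemma abs_expectation_le_concentration:
  assumes [measurable]: "X \<in> borel_measurable M" and sq: "integrable M (\<lambda>\<omega>. (X \<omega>)\<^sup>2)"
    and t: "t > 0" and p: "prob {\<omega> \<in> space M. \<epsilon> \<le> \<bar>X \<omega>\<bar>} \<le> 1 / 2"
  shows "\<bar>expectation X\<bar> \<le> \<epsilon> + t * variance X + prob {\<omega> \<in> space M. \<epsilon> \<le> \<bar>X \<omega>\<bar>} / t"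
proof -
  define A where "A = {\<omega> \<in> space M. \<epsilon> \<le> \<bar>X \<omega>\<bar>}"
  have [measurable]: "A \<in> events" by (simp add: A_def)
  have int: "integrable M X"
    using sq by (rule square_integrable_imp_integrable[rotated]) simp
  have main: "expectation Z - \<epsilon> \<le> t * variance Z + prob A / t"
    if Z: "integrable M Z" "integrable M (\<lambda>\<omega>. (Z \<omega>)\<^sup>2)" "\<And>\<omega>. \<bar>Z \<omega>\<bar> = \<bar>X \<omega>\<bar>" for Z
  proof (cases "expectation Z \<le> \<epsilon>")
    case True
    have "0 \<le> t * variance Z + prob A / t"
      using t variance_positive[of Z] by simp
    then show ?thesis using True by linarith
  next
    case False
    let ?a = "expectation Z"
    have int_sq: "integrable M (\<lambda>\<omega>. (Z \<omega> - ?a)\<^sup>2)"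
      using Z by (simp add: power2_diff)
    have pointwise: "(?a - \<epsilon>) * (1 - indicator A \<omega>) \<le>
        (?a - Z \<omega>) + t / 2 * (Z \<omega> - ?a)\<^sup>2 + 1 / (2 * t) * indicator A \<omega>" if "\<omega> \<in> space M" for \<omega>
    proof (cases "\<omega> \<in> A")
      case True
      \<comment> \<open>Young's inequality \<open>z \<le> t / 2 * z\<^sup>2 + 1 / (2 * t)\<close> for \<open>z = Z \<omega> - ?a\<close>.\<close>
      have "0 \<le> (t * (Z \<omega> - ?a) - 1)\<^sup>2 / (2 * t)" using t by simp
      also have "\<dots> = t / 2 * (Z \<omega> - ?a)\<^sup>2 - (Z \<omega> - ?a) + 1 / (2 * t)"
        using t by (simp add: power2_eq_square field_simps)
      finally show ?thesis using True by simp
    next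
      case False
      then have "Z \<omega> < \<epsilon>" using that Z(3)[of \<omega>] by (auto simp: A_def)
      moreover have "0 \<le> t / 2 * (Z \<omega> - ?a)\<^sup>2" using t by simp
      ultimately show ?thesis using False by simp
    qed
    have int_ind: "integrable M (indicator A :: 'a \<Rightarrow> real)"
      by (simp add: integrable_indicator_iff less_top[symmetric])
    have "expectation (\<lambda>\<omega>. (?a - \<epsilon>) * (1 - indicator A \<omega>)) \<le>
        expectation (\<lambda>\<omega>. (?a - Z \<omega>) + t / 2 * (Z \<omega> - ?a)\<^sup>2 + 1 / (2 * t) * indicator A \<omega>)"
      using Z(1) int_sq int_ind pointwise
      by (intro integral_mono Bochner_Integration.integrable_add Bochner_Integration.integrable_diff
            integrable_mult_right) auto
    also have "\<dots> = t / 2 * variance Z + 1 / (2 * t) * prob A"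
      using Z(1) int_sq int_ind by (simp add: prob_space)
    also have "expectation (\<lambda>\<omega>. (?a - \<epsilon>) * (1 - indicator A \<omega>)) = (?a - \<epsilon>) * (1 - prob A)"
      using int_ind by (simp add: prob_space)
    finally have "(?a - \<epsilon>) * (1 - prob A) \<le> t / 2 * variance Z + 1 / (2 * t) * prob A" .
    moreover have "(?a - \<epsilon>) * (1 / 2) \<le> (?a - \<epsilon>) * (1 - prob A)"
      using False p by (intro mult_left_mono) (auto simp: A_def)
    ultimately have "(?a - \<epsilon>) * (1 / 2) \<le> t / 2 * variance Z + 1 / (2 * t) * prob A" by linarith
    then show ?thesis by (simp add: field_simps)
  qed
  have "variance (\<lambda>\<omega>. - X \<omega>) = variance X"
    by (simp add: power2_commute)
  then show ?thesis
    using main[of X] main[of "\<lambda>\<omega>. - X \<omega>"] int sq by (auto simp: A_def)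
qed

lemma cmod_expectation_iexp_minus_1_le:
  assumes [measurable]: "X \<in> borel_measurable M" and "\<epsilon> > 0"
  shows "cmod (expectation (\<lambda>\<omega>. iexp (u * (X \<omega> - a))) - 1) \<le>
    \<bar>u\<bar> * (\<epsilon> + \<bar>a\<bar>) + 2 * prob {\<omega> \<in> space M. \<epsilon> \<le> \<bar>X \<omega>\<bar>}"
proof -
  define A where "A = {\<omega> \<in> space M. \<epsilon> \<le> \<bar>X \<omega>\<bar>}"
  have [measurable]: "A \<in> events" by (simp add: A_def)
  have int: "integrable M (\<lambda>\<omega>. iexp (u * (X \<omega> - a)))"
    by (intro integrable_const_bound[of _ 1]) auto
  have int_ind: "integrable M (indicator A :: 'a \<Rightarrow> real)"
    by (simp add: integrable_indicator_iff less_top[symmetric])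
  have pointwise: "cmod (iexp (u * (X \<omega> - a)) - 1) \<le> \<bar>u\<bar> * (\<epsilon> + \<bar>a\<bar>) + 2 * indicator A \<omega>"
    if "\<omega> \<in> space M" for \<omega>
  proof (cases "\<omega> \<in> A")
    case True
    have "cmod (iexp (u * (X \<omega> - a)) - 1) \<le> cmod (iexp (u * (X \<omega> - a))) + cmod 1"
      by (rule norm_triangle_ineq4)
    moreover have "0 \<le> \<bar>u\<bar> * (\<epsilon> + \<bar>a\<bar>)" using \<open>\<epsilon> > 0\<close> by simp
    ultimately show ?thesis using True by simp
  next
    case False
    have "cmod (iexp (u * (X \<omega> - a)) - 1) \<le> \<bar>u * (X \<omega> - a)\<bar>"
      using iexp_approx1[of "u * (X \<omega> - a)" 0] by simp
    also have "\<dots> \<le> \<bar>u\<bar> * (\<epsilon> + \<bar>a\<bar>)"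
      using False that unfolding abs_mult by (intro mult_left_mono) (auto simp: A_def)
    finally show ?thesis using False by simp
  qed
  have "expectation (\<lambda>\<omega>. iexp (u * (X \<omega> - a))) - 1 = expectation (\<lambda>\<omega>. iexp (u * (X \<omega> - a)) - 1)"
    using int by (simp add: prob_space)
  also have "cmod \<dots> \<le> expectation (\<lambda>\<omega>. \<bar>u\<bar> * (\<epsilon> + \<bar>a\<bar>) + 2 * indicator A \<omega>)"
    using int int_ind pointwise
    by (intro order_trans[OF integral_norm_bound integral_mono] integrable_norm
        Bochner_Integration.integrable_diff Bochner_Integration.integrable_add) auto
  also have "\<dots> = \<bar>u\<bar> * (\<epsilon> + \<bar>a\<bar>) + 2 * prob A"
    using int_ind by (simp add: prob_space)
  finally show ?thesis by (simp add: A_def)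
qed

text \<open>
Centring makes the linear term of the kernel integrate to \<open>0\<close>; this is where the compensator
\<open>1 + \<i> * u * x\<close> in the exponent comes from.
\<close>

lemma expectation_iexp_kolmogorov_kernel:
  assumes [measurable]: "Y \<in> borel_measurable M" and sq: "integrable M (\<lambda>\<omega>. (Y \<omega>)\<^sup>2)"
    and mean: "expectation Y = 0"
  shows "expectation (\<lambda>\<omega>. (Y \<omega>)\<^sup>2 *\<^sub>R kolmogorov_kernel u (Y \<omega>)) = expectation (\<lambda>\<omega>. iexp (u * Y \<omega>)) - 1"
    and "cmod (expectation (\<lambda>\<omega>. iexp (u * Y \<omega>)) - 1) \<le> u\<^sup>2 / 2 * expectation (\<lambda>\<omega>. (Y \<omega>)\<^sup>2)"
proof -
  have int: "integrable M Y"
    using sq by (rule square_integrable_imp_integrable[rotated]) simp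
  then have intc: "integrable M (\<lambda>\<omega>. complex_of_real (Y \<omega>))" by simp
  have inte: "integrable M (\<lambda>\<omega>. iexp (u * Y \<omega>))"
    by (intro integrable_const_bound[of _ 1]) auto
  have point: "(Y \<omega>)\<^sup>2 *\<^sub>R kolmogorov_kernel u (Y \<omega>) = iexp (u * Y \<omega>) - 1 - \<i> * complex_of_real u * complex_of_real (Y \<omega>)" for \<omega>
    by (cases "Y \<omega> = 0") (auto simp: kolmogorov_kernel_def scaleR_conv_of_real)
  have int1: "integrable M (\<lambda>\<omega>. iexp (u * Y \<omega>) - 1)"
    using inte by simp
  have int2: "integrable M (\<lambda>\<omega>. \<i> * complex_of_real u * complex_of_real (Y \<omega>))"
    using intc by simp
  have "expectation (\<lambda>\<omega>. (Y \<omega>)\<^sup>2 *\<^sub>R kolmogorov_kernel u (Y \<omega>)) =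
      expectation (\<lambda>\<omega>. iexp (u * Y \<omega>) - 1) - expectation (\<lambda>\<omega>. \<i> * complex_of_real u * complex_of_real (Y \<omega>))"
    unfolding point using int1 int2 by (rule Bochner_Integration.integral_diff)
  also have "\<dots> = expectation (\<lambda>\<omega>. iexp (u * Y \<omega>)) - 1"
    using inte mean by (simp add: prob_space)
  finally show *: "expectation (\<lambda>\<omega>. (Y \<omega>)\<^sup>2 *\<^sub>R kolmogorov_kernel u (Y \<omega>)) = expectation (\<lambda>\<omega>. iexp (u * Y \<omega>)) - 1" .
  have "cmod (expectation (\<lambda>\<omega>. (Y \<omega>)\<^sup>2 *\<^sub>R kolmogorov_kernel u (Y \<omega>))) \<le> expectation (\<lambda>\<omega>. u\<^sup>2 / 2 * (Y \<omega>)\<^sup>2)"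
  proof (rule order_trans[OF integral_norm_bound integral_mono])
    show "integrable M (\<lambda>\<omega>. cmod ((Y \<omega>)\<^sup>2 *\<^sub>R kolmogorov_kernel u (Y \<omega>)))"
      unfolding point by (intro integrable_norm Bochner_Integration.integrable_diff[OF int1 int2])
    show "integrable M (\<lambda>\<omega>. u\<^sup>2 / 2 * (Y \<omega>)\<^sup>2)" using sq by simp
    show "cmod ((Y \<omega>)\<^sup>2 *\<^sub>R kolmogorov_kernel u (Y \<omega>)) \<le> u\<^sup>2 / 2 * (Y \<omega>)\<^sup>2" for \<omega>
      using mult_right_mono[OF kolmogorov_kernel_le_square[of u "Y \<omega>"], of "(Y \<omega>)\<^sup>2"] by (simp add: mult.commute)
  qed
  then show "cmod (expectation (\<lambda>\<omega>. iexp (u * Y \<omega>)) - 1) \<le> u\<^sup>2 / 2 * expectation (\<lambda>\<omega>. (Y \<omega>)\<^sup>2)"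
    unfolding * by simp
qed

text \<open>
The comparison of a product of characteristic functions with its accompanying infinitely divisible
law. All factors on both sides have modulus at most \<open>1\<close>, so the products differ by at most the sum of
the differences, each of which is of the order of \<open>\<bar>\<phi> k - 1\<bar>\<^sup>2\<close>. One factor \<open>\<bar>\<phi> k - 1\<bar>\<close>
is bounded by \<open>\<eta>\<close>, the other by the variance.
\<close>

lemma char_sum_minus_exp_le:
  fixes X :: "'i \<Rightarrow> 'a \<Rightarrow> real"
  assumes fin: "finite I" and indep: "indep_vars (\<lambda>_. borel) X I"
    and meas: "\<And>k. k \<in> I \<Longrightarrow> X k \<in> borel_measurable M"
    and sq: "\<And>k. k \<in> I \<Longrightarrow> integrable M (\<lambda>\<omega>. (X k \<omega>)\<^sup>2)"
    and small: "\<And>k. k \<in> I \<Longrightarrow> cmod (expectation (\<lambda>\<omega>. iexp (u * (X k \<omega> - expectation (X k)))) - 1) \<le> \<eta>"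
    and "\<eta> \<le> 1"
  shows "cmod (char (distr M borel (\<lambda>\<omega>. \<Sum>k\<in>I. X k \<omega>)) u -
      exp (\<i> * complex_of_real (u * (\<Sum>k\<in>I. expectation (X k))) +
        (\<Sum>k\<in>I. expectation (\<lambda>\<omega>. iexp (u * (X k \<omega> - expectation (X k)))) - 1)))
    \<le> 3 / 2 * \<eta> * u\<^sup>2 * (\<Sum>k\<in>I. variance (X k))"
proof -
  let ?a = "\<lambda>k. expectation (X k)"
  define \<phi> where "\<phi> k = expectation (\<lambda>\<omega>. iexp (u * (X k \<omega> - ?a k)))" for k
  have ch: "char (distr M borel (X k)) u = iexp (u * ?a k) * \<phi> k" if k: "k \<in> I" for k
  proof -
    have "char (distr M borel (X k)) u = expectation (\<lambda>\<omega>. iexp (u * X k \<omega>))"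
      unfolding char_def using meas[OF k] by (subst integral_distr) auto
    also have "\<dots> = expectation (\<lambda>\<omega>. iexp (u * ?a k) * iexp (u * (X k \<omega> - ?a k)))"
      by (simp add: exp_add[symmetric] ring_distribs)
    finally show ?thesis unfolding \<phi>_def by simp
  qed
  have \<phi>_le: "cmod (\<phi> k) \<le> 1" if k: "k \<in> I" for k
  proof -
    have "cmod (\<phi> k) \<le> expectation (\<lambda>\<omega>. cmod (iexp (u * (X k \<omega> - ?a k))))"
      unfolding \<phi>_def by (rule integral_norm_bound)
    then show ?thesis by (simp add: prob_space)
  qed
  have var: "cmod (\<phi> k - 1) \<le> u\<^sup>2 / 2 * variance (X k)" if k: "k \<in> I" for k
  proof -
    have "integrable M (X k)"
      using sq[OF k] by (rule square_integrable_imp_integrable[rotated]) (rule meas[OF k])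
    then show ?thesis
      unfolding \<phi>_def using meas[OF k] sq[OF k]
      by (intro expectation_iexp_kolmogorov_kernel(2)) (auto simp: prob_space power2_diff)
  qed
  have \<phi>_exp: "cmod (\<phi> k - exp (\<phi> k - 1)) \<le> 3 / 2 * \<eta> * u\<^sup>2 * variance (X k)" if k: "k \<in> I" for k
  proof -
    have "cmod (\<phi> k - exp (\<phi> k - 1)) = cmod (exp (\<phi> k - 1) - 1 - (\<phi> k - 1))"
      by (simp add: norm_minus_commute)
    also have "\<dots> \<le> 3 * (cmod (\<phi> k - 1))\<^sup>2"
      using small[OF k] \<open>\<eta> \<le> 1\<close> by (intro cmod_exp_minus_linear_le) (simp add: \<phi>_def)
    also have "(cmod (\<phi> k - 1))\<^sup>2 \<le> \<eta> * (u\<^sup>2 / 2 * variance (X k))"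
      unfolding power2_eq_square[of "cmod _"]
      using small[OF k] var[OF k] order_trans[OF norm_ge_zero small[OF k]]
      by (intro mult_mono) (auto simp: \<phi>_def)
    finally show ?thesis by (simp add: mult_ac)
  qed
  have exp_le: "cmod (exp (\<phi> k - 1)) \<le> 1" if "k \<in> I" for k
    using \<phi>_le[OF that] complex_Re_le_cmod[of "\<phi> k"] by (simp add: norm_exp_eq_Re)
  have "char (distr M borel (\<lambda>\<omega>. \<Sum>k\<in>I. X k \<omega>)) u = (\<Prod>k\<in>I. iexp (u * ?a k) * \<phi> k)"
    unfolding char_distr_sum[OF indep] using ch by simp
  also have "\<dots> = iexp (u * (\<Sum>k\<in>I. ?a k)) * (\<Prod>k\<in>I. \<phi> k)"
    using fin by (simp add: prod.distrib exp_sum[symmetric] sum_distrib_left)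
  finally have "char (distr M borel (\<lambda>\<omega>. \<Sum>k\<in>I. X k \<omega>)) u -
      exp (\<i> * complex_of_real (u * (\<Sum>k\<in>I. ?a k)) + (\<Sum>k\<in>I. \<phi> k - 1)) =
      iexp (u * (\<Sum>k\<in>I. ?a k)) * ((\<Prod>k\<in>I. \<phi> k) - (\<Prod>k\<in>I. exp (\<phi> k - 1)))"
    using fin by (simp add: exp_add exp_sum right_diff_distrib)
  also have "cmod \<dots> = cmod ((\<Prod>k\<in>I. \<phi> k) - (\<Prod>k\<in>I. exp (\<phi> k - 1)))"
    by (simp add: norm_mult)
  also have "\<dots> \<le> (\<Sum>k\<in>I. cmod (\<phi> k - exp (\<phi> k - 1)))"
    using \<phi>_le exp_le by (rule norm_prod_diff)
  also have "\<dots> \<le> (\<Sum>k\<in>I. 3 / 2 * \<eta> * u\<^sup>2 * variance (X k))"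
    using \<phi>_exp by (rule sum_mono)
  also have "\<dots> = 3 / 2 * \<eta> * u\<^sup>2 * (\<Sum>k\<in>I. variance (X k))"
    by (simp add: sum_distrib_left)
  finally show ?thesis unfolding \<phi>_def .
qed

end

section \<open>Variance of a sum of independent variables\<close>

lemma (in prob_space) variance_sum_indep:
  fixes X :: "'i \<Rightarrow> 'a \<Rightarrow> real"
  assumes "finite I" "indep_vars (\<lambda>_. borel) X I"
    and "\<And>k. k \<in> I \<Longrightarrow> X k \<in> borel_measurable M"
    and "\<And>k. k \<in> I \<Longrightarrow> integrable M (\<lambda>\<omega>. (X k \<omega>)\<^sup>2)"
  shows "integrable M (\<lambda>\<omega>. (\<Sum>k\<in>I. X k \<omega>)\<^sup>2)"
    and "variance (\<lambda>\<omega>. \<Sum>k\<in>I. X k \<omega>) = (\<Sum>k\<in>I. variance (X k))"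
proof -
  have "integrable M (\<lambda>\<omega>. (\<Sum>k\<in>I. X k \<omega>)\<^sup>2) \<and> variance (\<lambda>\<omega>. \<Sum>k\<in>I. X k \<omega>) = (\<Sum>k\<in>I. variance (X k))"
    using assms
  proof (induction I rule: finite_induct)
    case empty
    then show ?case by simp
  next
    case (insert i F)
    let ?S = "\<lambda>\<omega>. \<Sum>k\<in>F. X k \<omega>"
    have IH: "integrable M (\<lambda>\<omega>. (?S \<omega>)\<^sup>2)" "variance ?S = (\<Sum>k\<in>F. variance (X k))"
      using insert.IH[OF indep_vars_subset[OF insert.prems(1)]] insert.prems by auto
    have ind: "indep_var borel (X i) borel ?S"
      using insert.hyps insert.prems(1) by (rule indep_vars_sum)
    have sqi: "integrable M (\<lambda>\<omega>. (X i \<omega>)\<^sup>2)" using insert.prems by simp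
    have measS: "?S \<in> borel_measurable M" using insert.prems(2) by (intro borel_measurable_sum) auto
    have inti: "integrable M (X i)" and intS: "integrable M ?S"
      using square_integrable_imp_integrable[OF insert.prems(2) sqi]
        square_integrable_imp_integrable[OF measS IH(1)] by auto
    note intp = indep_var_integrable[OF ind inti intS]
    have eq: "(X i \<omega> + ?S \<omega>)\<^sup>2 = (X i \<omega>)\<^sup>2 + 2 * (X i \<omega> * ?S \<omega>) + (?S \<omega>)\<^sup>2" for \<omega>
      by (simp add: power2_sum)
    have int: "integrable M (\<lambda>\<omega>. (X i \<omega> + ?S \<omega>)\<^sup>2)"
      unfolding eq using sqi intp IH(1) by (intro Bochner_Integration.integrable_add integrable_mult_right)
    have "expectation (\<lambda>\<omega>. (X i \<omega> + ?S \<omega>)\<^sup>2) =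
        expectation (\<lambda>\<omega>. (X i \<omega>)\<^sup>2) + 2 * (expectation (X i) * expectation ?S) + expectation (\<lambda>\<omega>. (?S \<omega>)\<^sup>2)"
      unfolding eq indep_var_lebesgue_integral[OF ind inti intS, symmetric]
      using Bochner_Integration.integral_add[OF Bochner_Integration.integrable_add[OF sqi integrable_mult_right[OF intp]] IH(1)]
        Bochner_Integration.integral_add[OF sqi integrable_mult_right[OF intp]] by simp
    moreover have "expectation (\<lambda>\<omega>. X i \<omega> + ?S \<omega>) = expectation (X i) + expectation ?S"
      using inti intS by (rule Bochner_Integration.integral_add)
    ultimately have "variance (\<lambda>\<omega>. X i \<omega> + ?S \<omega>) = variance (X i) + variance ?S"
      unfolding variance_eq[OF inti sqi] variance_eq[OF intS IH(1)]
        variance_eq[OF Bochner_Integration.integrable_add[OF inti intS] int]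
      by (simp add: power2_sum)
    then show ?case
      using int insert.hyps IH(2) by simp
  qed
  then show "integrable M (\<lambda>\<omega>. (\<Sum>k\<in>I. X k \<omega>)\<^sup>2)"
    "variance (\<lambda>\<omega>. \<Sum>k\<in>I. X k \<omega>) = (\<Sum>k\<in>I. variance (X k))" by auto
qed

section \<open>Rows of a triangular array\<close>

context
  fixes M :: "nat \<Rightarrow> 'a measure" and X :: "nat \<Rightarrow> nat \<Rightarrow> 'a \<Rightarrow> real" and kn :: "nat \<Rightarrow> nat"
  assumes arr: "independent_array M X kn"
begin

lemma independent_arrayD:
  assumes "n \<ge> 1"
  shows "prob_space (M n)" "prob_space.indep_vars (M n) (\<lambda>_. borel) (\<lambda>k. X k n) {1..kn n}"
    and "\<And>k. k \<in> {1..kn n} \<Longrightarrow> X k n \<in> borel_measurable (M n)"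
    and "\<And>k. k \<in> {1..kn n} \<Longrightarrow> integrable (M n) (\<lambda>\<omega>. (X k n \<omega>)\<^sup>2)"
    and "\<And>k. k \<in> {1..kn n} \<Longrightarrow> integrable (M n) (X k n)"
proof -
  show *: "prob_space (M n)" "prob_space.indep_vars (M n) (\<lambda>_. borel) (\<lambda>k. X k n) {1..kn n}"
    "\<And>k. k \<in> {1..kn n} \<Longrightarrow> X k n \<in> borel_measurable (M n)"
    "\<And>k. k \<in> {1..kn n} \<Longrightarrow> integrable (M n) (\<lambda>\<omega>. (X k n \<omega>)\<^sup>2)"
    using arr assms by (auto simp: independent_array_def)
  interpret prob_space "M n" by (rule *)
  show "\<And>k. k \<in> {1..kn n} \<Longrightarrow> integrable (M n) (X k n)"
    using square_integrable_imp_integrable *(3,4) by blast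
qed

lemma real_distribution_row_sum_law: "n \<ge> 1 \<Longrightarrow> real_distribution (row_sum_law M X kn n)"
  unfolding row_sum_law_def using independent_arrayD
  by (intro prob_space.real_distribution_distr borel_measurable_sum) auto

lemma row_sum_law_Chebyshev:
  assumes n: "n \<ge> 1" and r: "r > 0"
  shows "measure (row_sum_law M X kn n) {x. r \<le> \<bar>x - row_mean M X kn n\<bar>} \<le> row_variance M X kn n / r\<^sup>2"
proof -
  interpret prob_space "M n" by (rule independent_arrayD[OF n])
  let ?S = "\<lambda>\<omega>. \<Sum>k=1..kn n. X k n \<omega>"
  have measS: "?S \<in> borel_measurable (M n)"
    using independent_arrayD(3)[OF n] by (intro borel_measurable_sum) auto
  note var = variance_sum_indep[OF finite_atLeastAtMost independent_arrayD(2,3,4)[OF n]]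
  have "expectation ?S = row_mean M X kn n"
    unfolding row_mean_def using independent_arrayD(5)[OF n]
    by (intro Bochner_Integration.integral_sum) auto
  then have "prob {\<omega> \<in> space (M n). r \<le> \<bar>?S \<omega> - row_mean M X kn n\<bar>} \<le> row_variance M X kn n / r\<^sup>2"
    using Chebyshev_inequality[OF measS var(1) r] var(2) unfolding row_variance_def by simp
  moreover have "measure (distr (M n) borel ?S) {x. r \<le> \<bar>x - row_mean M X kn n\<bar>} =
      prob (?S -` {x. r \<le> \<bar>x - row_mean M X kn n\<bar>} \<inter> space (M n))"
    by (rule measure_distr[OF measS]) simp
  moreover have "?S -` {x. r \<le> \<bar>x - row_mean M X kn n\<bar>} \<inter> space (M n) =
      {\<omega> \<in> space (M n). r \<le> \<bar>?S \<omega> - row_mean M X kn n\<bar>}"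
    by auto
  ultimately show ?thesis unfolding row_sum_law_def by simp
qed

text \<open>
All four facts come from identifying \<open>row_df\<close> with the distribution function of the second moment
measure of the centred row. In particular its exponent is the sum of \<open>\<phi> k - 1\<close> exactly, not only
asymptotically.
\<close>

lemma row_df_properties:
  assumes n: "n \<ge> 1"
  shows "bounded_df (row_df M X kn n)" "(row_df M X kn n \<longlongrightarrow> 0) at_bot"
    and "measure (interval_measure (row_df M X kn n)) UNIV = row_variance M X kn n"
    and "kolmogorov_exponent (row_df M X kn n) u =
      (\<Sum>k=1..kn n. (LINT \<omega>|M n. iexp (u * (X k n \<omega> - (LINT \<omega>|M n. X k n \<omega>)))) - 1)"
proof -
  interpret prob_space "M n" by (rule independent_arrayD[OF n])
  define Y where "Y k \<omega> = X k n \<omega> - expectation (X k n)" for k \<omega>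
  have meas: "Y k \<in> borel_measurable (M n)" if "k \<in> {1..kn n}" for k
    unfolding Y_def using independent_arrayD(3)[OF n that] by simp
  have sq: "integrable (M n) (\<lambda>\<omega>. (Y k \<omega>)\<^sup>2)" if "k \<in> {1..kn n}" for k
    unfolding Y_def power2_diff using independent_arrayD(4,5)[OF n that] by simp
  have mean: "expectation (Y k) = 0" if "k \<in> {1..kn n}" for k
    unfolding Y_def using independent_arrayD(5)[OF n that] by (simp add: prob_space)
  let ?\<mu> = "second_moment_measure (M n) Y {1..kn n}"
  note Y = finite_atLeastAtMost[of 1 "kn n"] meas sq
  interpret S: finite_borel_measure ?\<mu>
    by (rule finite_borel_measure_second_moment[OF Y])
  have cdf_eq: "cdf ?\<mu> x = (\<Sum>k=1..kn n. LINT y:{..x}|interval_measure (cdf (distr (M n) borel (Y k))). y\<^sup>2)" for x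
    using Y by (rule cdf_second_moment_measure)
  have total: "measure ?\<mu> UNIV = (\<Sum>k=1..kn n. expectation (\<lambda>\<omega>. indicator UNIV (Y k \<omega>) * (Y k \<omega>)\<^sup>2))"
    using Y space_in_borel by (rule measure_second_moment_measure)
  have row: "row_df M X kn n = cdf ?\<mu>"
  proof
    show "row_df M X kn n x = cdf ?\<mu> x" for x
      unfolding cdf_eq row_df_def centered_cdf_def by (simp add: Y_def[abs_def])
  qed
  have int: "interval_measure (row_df M X kn n) = ?\<mu>"
    unfolding row by (rule bounded_df_cdf(2)[OF S.finite_borel_measure_axioms])
  show "bounded_df (row_df M X kn n)" "(row_df M X kn n \<longlongrightarrow> 0) at_bot"
    unfolding row using bounded_df_cdf(1)[OF S.finite_borel_measure_axioms] S.cdf_lim_at_bot by auto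
  show "measure (interval_measure (row_df M X kn n)) UNIV = row_variance M X kn n"
    unfolding int total row_variance_def by (simp add: Y_def)
  have "kolmogorov_exponent (row_df M X kn n) u =
      (\<Sum>k=1..kn n. expectation (\<lambda>\<omega>. (Y k \<omega>)\<^sup>2 *\<^sub>R kolmogorov_kernel u (Y k \<omega>)))"
    unfolding kolmogorov_exponent_kernel int
    using Y borel_measurable_kolmogorov_kernel kolmogorov_kernel_le_square
    by (rule integral_second_moment_measure)
  also have "\<dots> = (\<Sum>k=1..kn n. expectation (\<lambda>\<omega>. iexp (u * Y k \<omega>)) - 1)"
    using expectation_iexp_kolmogorov_kernel(1)[OF meas sq mean] by (intro sum.cong) auto
  finally show "kolmogorov_exponent (row_df M X kn n) u =
      (\<Sum>k=1..kn n. (LINT \<omega>|M n. iexp (u * (X k n \<omega> - (LINT \<omega>|M n. X k n \<omega>)))) - 1)"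
    by (simp add: Y_def)
qed

context
  fixes B :: real
  assumes uan: "UAN M X kn" and B: "\<And>n. n \<ge> 1 \<Longrightarrow> row_variance M X kn n \<le> B"
begin

lemma row_chars_uniformly_close_to_1:
  assumes "\<eta> > 0"
  shows "\<forall>\<^sub>F n in sequentially. \<forall>k\<in>{1..kn n}.
    cmod ((LINT \<omega>|M n. iexp (u * (X k n \<omega> - (LINT \<omega>|M n. X k n \<omega>)))) - 1) \<le> \<eta>"
proof -
  \<comment> \<open>The means will be at most \<open>3 * \<epsilon>\<close> and the exceptional probabilities at most \<open>\<epsilon>\<close>.\<close>
  define \<epsilon> where "\<epsilon> = \<eta> / (4 * \<bar>u\<bar> + 2)"
  have \<epsilon>: "\<epsilon> > 0" "(4 * \<bar>u\<bar> + 2) * \<epsilon> = \<eta>"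
    using assms by (auto simp: \<epsilon>_def)
  define t where "t = \<epsilon> / (\<bar>B\<bar> + 1)"
  have t: "t > 0" "t * \<bar>B\<bar> \<le> \<epsilon>"
    using \<epsilon>(1) by (auto simp: t_def field_simps)
  define \<delta> where "\<delta> = min (1 / 2) (min \<epsilon> (\<epsilon> * t))"
  have \<delta>: "\<delta> > 0" "\<delta> \<le> 1 / 2" "\<delta> \<le> \<epsilon>" "\<delta> \<le> \<epsilon> * t"
    using \<epsilon>(1) t(1) by (auto simp: \<delta>_def)
  let ?p = "\<lambda>n k. measure (M n) {\<omega> \<in> space (M n). \<epsilon> \<le> \<bar>X k n \<omega>\<bar>}"
  have "(\<lambda>n. SUP k\<in>{1..kn n}. ?p n k) \<longlonglongrightarrow> 0"
    using uan \<epsilon>(1) by (auto simp: UAN_def)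
  then have "\<forall>\<^sub>F n in sequentially. (SUP k\<in>{1..kn n}. ?p n k) < \<delta>"
    using \<delta>(1) by (rule order_tendstoD)
  moreover have "\<forall>\<^sub>F n in sequentially. n \<ge> 1" by (rule eventually_ge_at_top)
  ultimately show ?thesis
  proof eventually_elim
    case (elim n)
    interpret prob_space "M n" by (rule independent_arrayD[OF elim(2)])
    show ?case
    proof
      fix k assume k: "k \<in> {1..kn n}"
      let ?a = "expectation (X k n)"
      have p: "?p n k \<le> \<delta>"
        using cSUP_upper[OF k, of "?p n"] elim(1) by (auto simp: bdd_above_finite)
      have "variance (X k n) \<le> row_variance M X kn n"
        unfolding row_variance_def using k variance_positive by (intro member_le_sum) auto
      then have "variance (X k n) \<le> \<bar>B\<bar>" using B[OF elim(2)] by linarith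
      then have "t * variance (X k n) \<le> \<epsilon>"
        using t mult_left_mono[of "variance (X k n)" "\<bar>B\<bar>" t] by linarith
      moreover have "?p n k / t \<le> \<epsilon>"
        using p \<delta>(4) t(1) by (simp add: divide_le_eq)
      moreover have "\<bar>?a\<bar> \<le> \<epsilon> + t * variance (X k n) + ?p n k / t"
        using independent_arrayD(3,4)[OF elim(2) k] t(1) p \<delta>(2)
        by (intro abs_expectation_le_concentration) auto
      ultimately have "\<bar>u\<bar> * (\<epsilon> + \<bar>?a\<bar>) \<le> \<bar>u\<bar> * (4 * \<epsilon>)"
        by (intro mult_left_mono) auto
      then have "\<bar>u\<bar> * (\<epsilon> + \<bar>?a\<bar>) + 2 * ?p n k \<le> \<eta>"
        using p \<delta>(3) \<epsilon>(2) by (simp add: algebra_simps)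
      then show "cmod (expectation (\<lambda>\<omega>. iexp (u * (X k n \<omega> - ?a))) - 1) \<le> \<eta>"
        using cmod_expectation_iexp_minus_1_le[OF independent_arrayD(3)[OF elim(2) k] \<epsilon>(1), of u ?a]
        by linarith
    qed
  qed
qed

text \<open>
In the bound \<open>3 / 2 * \<eta> * u\<^sup>2 * row_variance\<close> negligibility makes \<open>\<eta>\<close> arbitrarily small, while the
variances stay bounded.
\<close>

lemma row_sum_char_asymptotics:
  "(\<lambda>n. char (row_sum_law M X kn n) u -
     exp (\<i> * complex_of_real (u * row_mean M X kn n) + kolmogorov_exponent (row_df M X kn n) u)) \<longlonglongrightarrow> 0"
proof (rule tendstoI)
  fix e :: real assume e: "e > 0"
  define \<eta> where "\<eta> = min 1 (e / (3 * u\<^sup>2 * \<bar>B\<bar> + 1))"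
  have pos: "3 * u\<^sup>2 * \<bar>B\<bar> + 1 > 0" by (intro add_nonneg_pos) auto
  then have \<eta>: "\<eta> > 0" "\<eta> \<le> 1" "\<eta> * (3 * u\<^sup>2 * \<bar>B\<bar> + 1) \<le> e"
    using e by (auto simp: \<eta>_def min_le_iff_disj simp flip: pos_le_divide_eq)
  have "\<forall>\<^sub>F n in sequentially. n \<ge> (1::nat)" by (rule eventually_ge_at_top)
  with row_chars_uniformly_close_to_1[OF \<eta>(1), of u]
  show "\<forall>\<^sub>F n in sequentially. dist (char (row_sum_law M X kn n) u -
     exp (\<i> * complex_of_real (u * row_mean M X kn n) + kolmogorov_exponent (row_df M X kn n) u)) 0 < e"
  proof eventually_elim
    case (elim n)
    interpret prob_space "M n" by (rule independent_arrayD[OF elim(2)])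
    have "cmod (char (row_sum_law M X kn n) u -
        exp (\<i> * complex_of_real (u * row_mean M X kn n) + kolmogorov_exponent (row_df M X kn n) u))
        \<le> 3 / 2 * \<eta> * u\<^sup>2 * row_variance M X kn n"
      unfolding row_sum_law_def row_mean_def row_variance_def row_df_properties(4)[OF elim(2)]
      using finite_atLeastAtMost independent_arrayD(2,3,4)[OF elim(2)] elim(1)[rule_format] \<eta>(2)
      by (rule char_sum_minus_exp_le)
    also have "\<dots> \<le> 3 / 2 * \<eta> * u\<^sup>2 * \<bar>B\<bar>"
      using B[OF elim(2)] \<eta>(1) by (intro mult_left_mono) auto
    also have "\<dots> < \<eta> * (3 * u\<^sup>2 * \<bar>B\<bar> + 1)"
    proof -
      have "0 \<le> \<eta> * (u\<^sup>2 * \<bar>B\<bar>)" using \<eta>(1) by simp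
      moreover have "3 / 2 * \<eta> * u\<^sup>2 * \<bar>B\<bar> = 3 / 2 * (\<eta> * (u\<^sup>2 * \<bar>B\<bar>))"
        "\<eta> * (3 * u\<^sup>2 * \<bar>B\<bar> + 1) = 3 * (\<eta> * (u\<^sup>2 * \<bar>B\<bar>)) + \<eta>"
        by (simp_all add: algebra_simps)
      ultimately show ?thesis using \<eta>(1) by linarith
    qed
    also have "\<dots> \<le> e" by (rule \<eta>(3))
    finally show ?case by simp
  qed
qed

end

end

section \<open>Limits of laws with Kolmogorov asymptotics\<close>

lemma weak_conv_subseq: "weak_conv Ks K \<Longrightarrow> strict_mono s \<Longrightarrow> weak_conv (\<lambda>n. Ks (s n)) K"
  unfolding weak_conv_def using LIMSEQ_subseq_LIMSEQ[unfolded comp_def] by fast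

text \<open>
The information on the array that determines the limit behaviour: the laws \<open>P n\<close> are asymptotically
those given by the drift \<open>a n\<close> and the distribution function \<open>Ks n\<close>, and they concentrate around
\<open>a n\<close> uniformly in \<open>n\<close>.
\<close>

locale kolmogorov_approximation =
  fixes P :: "nat \<Rightarrow> real measure" and a :: "nat \<Rightarrow> real" and Ks :: "nat \<Rightarrow> real \<Rightarrow> real" and B :: real
  assumes P: "\<And>n. real_distribution (P n)"
    and Ks: "\<And>n. bounded_df (Ks n)" "\<And>n. (Ks n \<longlongrightarrow> 0) at_bot"
    and mass_le: "\<And>n. measure (interval_measure (Ks n)) UNIV \<le> B"
    and Chebyshev: "\<And>n r. r > 0 \<Longrightarrow> measure (P n) {x. r \<le> \<bar>x - a n\<bar>} \<le> B / r\<^sup>2"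
    and char_asymptotics: "\<And>u. (\<lambda>n. char (P n) u -
      exp (\<i> * complex_of_real (u * a n) + kolmogorov_exponent (Ks n) u)) \<longlonglongrightarrow> 0"
begin

lemma B_nonneg: "B \<ge> 0"
  using mass_le[of 0] measure_nonneg order_trans by blast

lemma Ks_bounds: "0 \<le> Ks n x" "Ks n x \<le> measure (interval_measure (Ks n)) UNIV"
proof -
  interpret finite_borel_measure "interval_measure (Ks n)"
    by (rule finite_borel_measure_bounded_df[OF Ks(1)])
  show "0 \<le> Ks n x" "Ks n x \<le> measure (interval_measure (Ks n)) UNIV"
    using cdf_nonneg[of x] cdf_bounded[of x]
    by (simp_all add: cdf_interval_measure_bounded_df[OF Ks] borel_UNIV)
qed

lemma ex_Chebyshev_radius:
  assumes "\<epsilon> > 0"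
  obtains r where "r > 0" "B / r\<^sup>2 < \<epsilon>"
proof
  show "sqrt ((B + 1) / \<epsilon>) > 0" using assms B_nonneg by simp
  show "B / (sqrt ((B + 1) / \<epsilon>))\<^sup>2 < \<epsilon>"
    using assms B_nonneg by (simp add: field_simps)
qed

lemma tight_if_Bseq:
  assumes "Bseq a"
  shows "tight P"
  unfolding tight_def
proof (intro conjI allI impI)
  fix \<epsilon> :: real assume \<epsilon>: "\<epsilon> > 0"
  obtain r where r: "r > 0" "B / r\<^sup>2 < \<epsilon>" using ex_Chebyshev_radius[OF \<epsilon>] .
  obtain A where A: "A > 0" "\<And>n. \<bar>a n\<bar> \<le> A" using assms by (auto simp: Bseq_def)
  have "1 - \<epsilon> < measure (P n) {- (A + r)<..A + r}" for n
  proof -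
    interpret real_distribution "P n" by (rule P)
    have "measure (P n) (- {- (A + r)<..A + r}) \<le> measure (P n) {x. r \<le> \<bar>x - a n\<bar>}"
      using A(2)[of n] by (intro finite_measure_mono) auto
    then have "measure (P n) (- {- (A + r)<..A + r}) < \<epsilon>"
      using Chebyshev[OF r(1), of n] r(2) by linarith
    moreover have "measure (P n) (- {- (A + r)<..A + r}) = 1 - measure (P n) {- (A + r)<..A + r}"
      using prob_compl[of "{- (A + r)<..A + r}"] by (simp add: Compl_eq_Diff_UNIV)
    ultimately show ?thesis by simp
  qed
  moreover have "- (A + r) < A + r" using A(1) r(1) by simp
  ultimately show "\<exists>a b. a < b \<and> (\<forall>n. 1 - \<epsilon> < measure (P n) {a<..b})" by blast
qed (rule P)

text \<open>
Eventually \<open>P n\<close> has more than three quarters of its mass to the left of \<open>L1\<close> and to the right of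
\<open>L0\<close>, two points determined by the limit law, and more than three quarters within distance \<open>r\<close> of \<open>a n\<close>,
by Chebyshev's inequality. This is impossible if \<open>a n\<close> is far from both points.
\<close>

lemma Bseq_if_weak_conv:
  assumes N: "real_distribution N" and conv: "weak_conv_m P N"
  shows "Bseq a"
proof -
  interpret N: real_distribution N by (rule N)
  have mono: "mono (cdf N)" by (simp add: mono_def N.cdf_nondecreasing)
  obtain r where r: "r > 0" "B / r\<^sup>2 < 1 / 4" using ex_Chebyshev_radius[of "1 / 4"] by auto
  have "\<forall>\<^sub>F x in at_top. 3 / 4 < cdf N x" "\<forall>\<^sub>F x in at_bot. cdf N x < 1 / 4"
    by (rule order_tendstoD(1)[OF N.cdf_lim_at_top_prob] order_tendstoD(2)[OF N.cdf_lim_at_bot], simp)+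
  then obtain l0 l1 where l: "\<And>x. l1 \<le> x \<Longrightarrow> 3 / 4 < cdf N x" "\<And>x. x \<le> l0 \<Longrightarrow> cdf N x < 1 / 4"
    by (auto simp: eventually_at_top_linorder eventually_at_bot_linorder)
  obtain L1 where L1: "l1 < L1" "isCont (cdf N) L1" using ex_isCont_mono[OF mono, of l1 "l1 + 1"] by auto
  obtain L0 where L0: "L0 < l0" "isCont (cdf N) L0" using ex_isCont_mono[OF mono, of "l0 - 1" l0] by auto
  have "(\<lambda>n. cdf (P n) L1) \<longlonglongrightarrow> cdf N L1" "(\<lambda>n. cdf (P n) L0) \<longlonglongrightarrow> cdf N L0"
    using conv L1(2) L0(2) by (auto simp: weak_conv_m_def weak_conv_def)
  moreover have "3 / 4 < cdf N L1" "cdf N L0 < 1 / 4" using l L1(1) L0(1) by auto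
  ultimately have "\<forall>\<^sub>F n in sequentially. 3 / 4 < cdf (P n) L1" "\<forall>\<^sub>F n in sequentially. cdf (P n) L0 < 1 / 4"
    using order_tendstoD by blast+
  then have "\<forall>\<^sub>F n in sequentially. \<bar>a n\<bar> \<le> \<bar>L0\<bar> + \<bar>L1\<bar> + r"
  proof eventually_elim
    case (elim n)
    interpret real_distribution "P n" by (rule P)
    have far: "measure (P n) {x. r \<le> \<bar>x - a n\<bar>} < 1 / 4"
      using Chebyshev[OF r(1), of n] r(2) by linarith
    have "a n < L1 + r"
    proof (rule ccontr)
      assume "\<not> a n < L1 + r"
      then have "cdf (P n) L1 \<le> measure (P n) {x. r \<le> \<bar>x - a n\<bar>}"
        unfolding cdf_def by (intro finite_measure_mono) auto
      then show False using far elim(1) by linarith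
    qed
    moreover have "L0 - r < a n"
    proof (rule ccontr)
      assume "\<not> L0 - r < a n"
      then have "measure (P n) (UNIV - {..L0}) \<le> measure (P n) {x. r \<le> \<bar>x - a n\<bar>}"
        by (intro finite_measure_mono) auto
      moreover have "measure (P n) (UNIV - {..L0}) = 1 - cdf (P n) L0"
        using prob_compl[of "{..L0}"] by (simp add: cdf_def)
      ultimately show False using far elim(2) by linarith
    qed
    ultimately show ?case using r(1) by linarith
  qed
  then show ?thesis by (intro BfunI) simp
qed

lemma char_subseq_limit:
  assumes s: "strict_mono s" and K: "bounded_df K" "weak_conv (\<lambda>n. Ks (s n)) K"
    and a: "(\<lambda>n. a (s n)) \<longlonglongrightarrow> \<alpha>"
  shows "(\<lambda>n. char (P (s n)) u) \<longlonglongrightarrow> exp (\<i> * complex_of_real (u * \<alpha>) + kolmogorov_exponent K u)"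
proof -
  let ?e = "\<lambda>n. exp (\<i> * complex_of_real (u * a n) + kolmogorov_exponent (Ks n) u)"
  have "(\<lambda>n. kolmogorov_exponent (Ks (s n)) u) \<longlonglongrightarrow> kolmogorov_exponent K u"
    using Ks(1) mass_le K by (rule weak_conv_kolmogorov_exponent)
  then have "(\<lambda>n. ?e (s n)) \<longlonglongrightarrow> exp (\<i> * complex_of_real (u * \<alpha>) + kolmogorov_exponent K u)"
    using a by (intro tendsto_intros)
  from tendsto_add[OF LIMSEQ_subseq_LIMSEQ[OF char_asymptotics[of u] s, unfolded comp_def] this]
  show ?thesis by simp
qed

text \<open>
The characteristic functions converge, but for the continuity theorem the limit has to be known to be
a characteristic function. Tightness provides this: some subsequence converges weakly, and its limit
has the required transform.
\<close>

lemma weak_conv_kolmogorov_law: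
  assumes K: "bounded_df K" "weak_conv Ks K" and a: "a \<longlonglongrightarrow> \<alpha>"
  shows "weak_conv_m P (shift_law (kolmogorov_law K) \<alpha>)"
    and "real_distribution (kolmogorov_law K)"
    and "char (kolmogorov_law K) u = exp (kolmogorov_exponent K u)"
proof -
  have "Bseq a" using a by (intro convergent_imp_Bseq convergentI)
  then have "tight P" by (rule tight_if_Bseq)
  from tight_imp_convergent_subsubsequence[OF this strict_mono_id]
  obtain r N where r: "strict_mono r" "real_distribution N" "weak_conv_m (P \<circ> id \<circ> r) N" by blast
  note lim = char_subseq_limit[OF _ K(1) weak_conv_subseq[OF K(2)] LIMSEQ_subseq_LIMSEQ[OF a, unfolded comp_def]]
  have char: "char N u = exp (\<i> * complex_of_real (u * \<alpha>) + kolmogorov_exponent K u)" for u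
  proof (rule LIMSEQ_unique)
    show "(\<lambda>n. char (P (r n)) u) \<longlonglongrightarrow> char N u"
      using levy_continuity1[OF _ r(2,3), of u] P by simp
    show "(\<lambda>n. char (P (r n)) u) \<longlonglongrightarrow> exp (\<i> * complex_of_real (u * \<alpha>) + kolmogorov_exponent K u)"
      using r(1) by (intro lim)
  qed
  show "real_distribution (kolmogorov_law K)" "char (kolmogorov_law K) u = exp (kolmogorov_exponent K u)"
    using shift_kolmogorov_law_eqI(2,3)[OF r(2) char] by auto
  have "weak_conv_m P N"
    using P r(2)
  proof (rule levy_continuity)
    show "(\<lambda>n. char (P n) t) \<longlonglongrightarrow> char N t" for t
      unfolding char using lim[OF strict_mono_id] by simp
  qed
  then show "weak_conv_m P (shift_law (kolmogorov_law K) \<alpha>)"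
    using shift_kolmogorov_law_eqI(1)[OF r(2) char] by simp
qed

lemma ex_convergent_subseq:
  assumes "Bseq a" and s: "strict_mono (s :: nat \<Rightarrow> nat)"
  obtains r K \<alpha> where "strict_mono (r :: nat \<Rightarrow> nat)" "bounded_df K" "weak_conv (\<lambda>n. Ks (s (r n))) K"
    "(\<lambda>n. a (s (r n))) \<longlonglongrightarrow> \<alpha>"
proof -
  have "\<bar>Ks (s n) x\<bar> \<le> B" for n x
    using Ks_bounds[of "s n" x] mass_le[of "s n"] by simp
  from Helly_selection[of "\<lambda>n. Ks (s n)", OF _ _ this]
  obtain r1 K where r1: "strict_mono r1" and K: "\<And>x. continuous (at_right x) K" "mono K" "\<And>x. \<bar>K x\<bar> \<le> B"
    and conv: "\<And>x. isCont K x \<Longrightarrow> (\<lambda>n. Ks (s (r1 n)) x) \<longlonglongrightarrow> K x"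
    using Ks(1) by (auto simp: bounded_df_def)
  have "bounded (range (\<lambda>n. a (s (r1 n))))"
    using \<open>Bseq a\<close> by (auto simp: Bseq_def bounded_iff)
  then obtain \<alpha> r2 where r2: "strict_mono r2" "((\<lambda>n. a (s (r1 n))) \<circ> r2) \<longlonglongrightarrow> \<alpha>"
    using bounded_imp_convergent_subsequence by blast
  show thesis
  proof (rule that)
    show "strict_mono (\<lambda>n. r1 (r2 n))" using strict_mono_o[OF r1 r2(1)] by (simp add: comp_def)
    show "bounded_df K" using K by (auto simp: bounded_df_def bounded_iff)
    have "weak_conv (\<lambda>n. Ks (s (r1 n))) K" using conv by (simp add: weak_conv_def)
    then show "weak_conv (\<lambda>n. Ks (s (r1 (r2 n)))) K" using r2(1) by (rule weak_conv_subseq)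
    show "(\<lambda>n. a (s (r1 (r2 n)))) \<longlonglongrightarrow> \<alpha>" using r2(2) by (simp add: comp_def)
  qed
qed

text \<open>
The limit takes values in \<open>[0, c]\<close> and has total increment \<open>c\<close>, so it has to start at \<open>0\<close>. This
excludes the constant that mass escaping to minus infinity would leave behind.
\<close>

lemma no_mass_loss_imp_lim_at_bot:
  assumes s: "strict_mono s" and K: "bounded_df K" "weak_conv (\<lambda>n. Ks (s n)) K"
    and c: "(\<lambda>n. measure (interval_measure (Ks n)) UNIV) \<longlonglongrightarrow> c" "measure (interval_measure K) UNIV = c"
  shows "(K \<longlongrightarrow> 0) at_bot"
proof -
  obtain l where l: "(K \<longlongrightarrow> l) at_bot" "\<And>x. l \<le> K x" using bounded_df_lim_at_bot[OF K(1)] by blast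
  obtain m where m: "(K \<longlongrightarrow> m) at_top" "\<And>x. K x \<le> m" using bounded_df_lim_at_top[OF K(1)] by blast
  have mono: "mono K" using K(1) by (simp add: bounded_df_def)
  have cont: "0 \<le> K x" "K x \<le> c" if "isCont K x" for x
  proof -
    have conv: "(\<lambda>n. Ks (s n) x) \<longlonglongrightarrow> K x" using K(2) that by (simp add: weak_conv_def)
    show "0 \<le> K x" using conv Ks_bounds(1) by (intro LIMSEQ_le_const) auto
    show "K x \<le> c"
      using conv LIMSEQ_subseq_LIMSEQ[OF c(1) s, unfolded comp_def] Ks_bounds(2)
      by (intro LIMSEQ_le) auto
  qed
  have "0 \<le> K x" "K x \<le> c" for x
  proof -
    obtain y where "x - 1 < y" "y < x" "isCont K y" using ex_isCont_mono[OF mono, of "x - 1" x] by auto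
    then show "0 \<le> K x" using cont(1)[of y] monoD[OF mono, of y x] by linarith
    obtain z where "x < z" "z < x + 1" "isCont K z" using ex_isCont_mono[OF mono, of x "x + 1"] by auto
    then show "K x \<le> c" using cont(2)[of z] monoD[OF mono, of x z] by linarith
  qed
  then have "0 \<le> l" "m \<le> c"
    using tendsto_lowerbound[OF l(1)] tendsto_upperbound[OF m(1)] by auto
  moreover have "c = m - l"
    using bounded_df_measure(3)[OF K(1) l(1) m(1)] c(2) by simp
  ultimately have "l = 0" by simp
  then show ?thesis using l(1) by simp
qed

text \<open>
The function \<open>K\<close> is a limit along one subsequence. Limits along other subsequences represent the same
law, hence have the same measure and differ from \<open>K\<close> by a constant only; so increments converge
along the whole sequence. Taking \<open>K\<close> itself as a subsequential limit, instead of normalising it,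
makes the last two conclusions hold without an adjustment of \<open>K\<close>: if the values at one point
converge at all, they converge to \<open>K\<close> there.
\<close>

lemma kolmogorov_representation_of_limit:
  assumes N: "real_distribution N" and conv: "weak_conv_m P N"
  obtains \<alpha> K where "a \<longlonglongrightarrow> \<alpha>" "bounded_df K" "N = shift_law (kolmogorov_law K) \<alpha>"
    "real_distribution (kolmogorov_law K)"
    "\<And>u. char (kolmogorov_law K) u = exp (kolmogorov_exponent K u)"
    "\<exists>b. weak_conv (\<lambda>n x. Ks n x - b n) K"
    "\<And>x. isCont K x \<Longrightarrow> convergent (\<lambda>n. Ks n x) \<Longrightarrow> weak_conv Ks K"
    "(\<lambda>n. measure (interval_measure (Ks n)) UNIV) \<longlonglongrightarrow> measure (interval_measure K) UNIV \<Longrightarrow> weak_conv Ks K"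
proof -
  have bdd: "Bseq a" using N conv by (rule Bseq_if_weak_conv)
  have char_lim: "(\<lambda>n. char (P n) u) \<longlonglongrightarrow> char N u" for u
    using P N conv by (rule levy_continuity1)
  have char_N: "char N u = exp (\<i> * complex_of_real (u * \<alpha>) + kolmogorov_exponent K u)"
    if "strict_mono s" "bounded_df K" "weak_conv (\<lambda>n. Ks (s n)) K" "(\<lambda>n. a (s n)) \<longlonglongrightarrow> \<alpha>" for s K \<alpha> u
    using LIMSEQ_unique[OF LIMSEQ_subseq_LIMSEQ[OF char_lim that(1), unfolded comp_def] char_subseq_limit[OF that]] .
  obtain r0 K \<alpha> where r0: "strict_mono r0" and K: "bounded_df K" "weak_conv (\<lambda>n. Ks (r0 n)) K"
    and \<alpha>: "(\<lambda>n. a (r0 n)) \<longlonglongrightarrow> \<alpha>"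
    using ex_convergent_subseq[OF bdd strict_mono_id] by auto
  note charN = char_N[OF r0 K \<alpha>]
  have unique: "\<exists>r L. strict_mono r \<and> strict_mono (\<lambda>n. s (r n)) \<and> (\<lambda>n. a (s (r n))) \<longlonglongrightarrow> \<alpha> \<and> bounded_df L \<and>
      weak_conv (\<lambda>n. Ks (s (r n))) L \<and> interval_measure L = interval_measure K"
    if s: "strict_mono s" for s :: "nat \<Rightarrow> nat"
  proof -
    obtain r L \<beta> where r: "strict_mono r" and L: "bounded_df L" "weak_conv (\<lambda>n. Ks (s (r n))) L"
      and \<beta>: "(\<lambda>n. a (s (r n))) \<longlonglongrightarrow> \<beta>"
      using ex_convergent_subseq[OF bdd s] .
    have sr: "strict_mono (\<lambda>n. s (r n))" using strict_mono_o[OF s r] by (simp add: comp_def)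
    have "exp (\<i> * complex_of_real (u * \<beta>) + kolmogorov_exponent L u) =
        exp (\<i> * complex_of_real (u * \<alpha>) + kolmogorov_exponent K u)" for u
      using char_N[OF sr L \<beta>, of u] charN[of u] by simp
    from kolmogorov_representation_unique[OF L(1) K(1) this]
    show ?thesis using r sr L \<beta> by blast
  qed
  have a_lim: "a \<longlonglongrightarrow> \<alpha>"
    by (rule LIMSEQ_if_subsubsequences) (use unique in blast)
  have isCont_L: "isCont L x" if "bounded_df L" "interval_measure L = interval_measure K" "isCont K x" for L x
  proof -
    have "L y = K y + (L 0 - K 0)" for y
      using interval_measure_eqD[OF that(1) K(1) that(2), of y 0] by linarith
    then have "L = (\<lambda>y. K y + (L 0 - K 0))" by blast
    moreover have "isCont (\<lambda>y. K y + (L 0 - K 0)) x" using that(3) by (intro continuous_intros)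
    ultimately show ?thesis by simp
  qed
  have increments: "(\<lambda>n. Ks n x - Ks n y) \<longlonglongrightarrow> K x - K y" if xy: "isCont K x" "isCont K y" for x y
  proof (rule LIMSEQ_if_subsubsequences)
    fix s :: "nat \<Rightarrow> nat" assume "strict_mono s"
    from unique[OF this] obtain r L where r: "strict_mono r" "bounded_df L"
      "weak_conv (\<lambda>n. Ks (s (r n))) L" "interval_measure L = interval_measure K" by blast
    have "(\<lambda>n. Ks (s (r n)) x - Ks (s (r n)) y) \<longlonglongrightarrow> L x - L y"
      using r(3) isCont_L[OF r(2,4)] xy unfolding weak_conv_def by (intro tendsto_diff) auto
    then show "\<exists>r. strict_mono r \<and> (\<lambda>n. Ks (s (r n)) x - Ks (s (r n)) y) \<longlonglongrightarrow> K x - K y"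
      using r(1) interval_measure_eqD[OF r(2) K(1) r(4), of x y] by auto
  qed
  show thesis
  proof (rule that[OF a_lim K(1) shift_kolmogorov_law_eqI[OF N charN]])
    obtain x0 where x0: "isCont K x0"
      using ex_isCont_mono[of K 0 1] K(1) by (auto simp: bounded_df_def)
    have "(\<lambda>n. Ks n x - (Ks n x0 - K x0)) \<longlonglongrightarrow> K x" if "isCont K x" for x
      using tendsto_add[OF increments[OF that x0] tendsto_const[of "K x0"]] by (simp add: algebra_simps)
    then show "\<exists>b. weak_conv (\<lambda>n x. Ks n x - b n) K"
      unfolding weak_conv_def by (intro exI[of _ "\<lambda>n. Ks n x0 - K x0"]) blast
  next
    fix x assume x: "isCont K x" "convergent (\<lambda>n. Ks n x)"
    then obtain l where l: "(\<lambda>n. Ks n x) \<longlonglongrightarrow> l" by (auto simp: convergent_def)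
    have "l = K x"
      using LIMSEQ_unique[OF LIMSEQ_subseq_LIMSEQ[OF l r0, unfolded comp_def]] K(2) x(1)
      by (auto simp: weak_conv_def)
    then have "(\<lambda>n. Ks n y) \<longlonglongrightarrow> K y" if "isCont K y" for y
      using tendsto_add[OF increments[OF that x(1)] l] by simp
    then show "weak_conv Ks K" by (simp add: weak_conv_def)
  next
    assume mass: "(\<lambda>n. measure (interval_measure (Ks n)) UNIV) \<longlonglongrightarrow> measure (interval_measure K) UNIV"
    have K0: "(K \<longlongrightarrow> 0) at_bot" using no_mass_loss_imp_lim_at_bot[OF r0 K mass refl] .
    have "(\<lambda>n. Ks n x) \<longlonglongrightarrow> K x" if x: "isCont K x" for x
    proof (rule LIMSEQ_if_subsubsequences)
      fix s :: "nat \<Rightarrow> nat" assume "strict_mono s"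
      from unique[OF this] obtain r L where r: "strict_mono r" "strict_mono (\<lambda>n. s (r n))" "bounded_df L"
        "weak_conv (\<lambda>n. Ks (s (r n))) L" "interval_measure L = interval_measure K" by blast
      have L0: "(L \<longlongrightarrow> 0) at_bot"
        using no_mass_loss_imp_lim_at_bot[OF r(2,3,4) mass] r(5) by simp
      have "L = K"
        using cdf_interval_measure_bounded_df[OF K(1) K0] cdf_interval_measure_bounded_df[OF r(3) L0] r(5)
        by simp
      then show "\<exists>r. strict_mono r \<and> (\<lambda>n. Ks (s (r n)) x) \<longlonglongrightarrow> K x"
        using r(1,4) x by (auto simp: weak_conv_def)
    qed
    then show "weak_conv Ks K" by (simp add: weak_conv_def)
  qed
qed

end

section \<open>The limit theorem for arrays of bounded variance\<close>

lemma weak_conv_Suc_iff: "weak_conv (\<lambda>n. F (Suc n)) K \<longleftrightarrow> weak_conv F K"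
  unfolding weak_conv_def using filterlim_sequentially_Suc[of "\<lambda>n. F n x" for x] by blast

lemma BVH_or_VCH_imp_bounded:
  assumes "BVH M X kn \<or> (\<exists>c. VCH M X kn c)"
  obtains B where "\<And>n. n \<ge> 1 \<Longrightarrow> row_variance M X kn n \<le> B"
proof -
  have "\<exists>B. \<forall>n\<ge>1. row_variance M X kn n \<le> B"
    using assms
  proof
    assume "BVH M X kn"
    then show ?thesis by (auto simp: BVH_def bdd_above_def)
  next
    assume "\<exists>c. VCH M X kn c"
    then have "Bseq (row_variance M X kn)"
      by (auto simp: VCH_def intro: convergent_imp_Bseq convergentI)
    then show ?thesis by (auto simp: Bseq_def intro: order_trans[OF abs_ge_self])
  qed
  then show thesis using that by blast
qed

theorem theorem3:
  fixes M :: "nat \<Rightarrow> 'a measure"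
    and X :: "nat \<Rightarrow> nat \<Rightarrow> 'a \<Rightarrow> real"
    and kn :: "nat \<Rightarrow> nat"
  assumes "independent_array M X kn"
    and "filterlim kn at_top sequentially"
    and "UAN M X kn"
    and "BVH M X kn \<or> (\<exists>c. VCH M X kn c)"
  shows
    "(\<forall>K a. bounded_df K \<and> weak_conv (row_df M X kn) K \<and> row_mean M X kn \<longlonglongrightarrow> a \<longrightarrow>
        weak_conv_m (row_sum_law M X kn) (shift_law (kolmogorov_law K) a) \<and>
        (\<forall>c. VCH M X kn c \<and> prob_space.variance (kolmogorov_law K) (\<lambda>y. y) = c \<longrightarrow>
           df_weak_conv (row_df M X kn) K)) \<and>
     (\<forall>N. real_distribution N \<and> weak_conv_m (row_sum_law M X kn) N \<longrightarrow>
        (\<exists>a. row_mean M X kn \<longlonglongrightarrow> a \<and>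
          (\<exists>K. bounded_df K \<and> N = shift_law (kolmogorov_law K) a \<and>
             (\<exists>b. weak_conv (\<lambda>n x. row_df M X kn n x - b n) K) \<and>
             ((\<exists>x. isCont K x \<and> convergent (\<lambda>n. row_df M X kn n x)) \<longrightarrow>
                weak_conv (row_df M X kn) K) \<and>
             (\<forall>c. VCH M X kn c \<and> prob_space.variance (kolmogorov_law K) (\<lambda>y. y) = c \<longrightarrow>
                df_weak_conv (row_df M X kn) K))))"
proof -
  let ?P = "row_sum_law M X kn" and ?a = "row_mean M X kn" and ?K = "row_df M X kn"
  note arr = assms(1)
  obtain B where B: "\<And>n. n \<ge> 1 \<Longrightarrow> row_variance M X kn n \<le> B"
    using BVH_or_VCH_imp_bounded[OF assms(4)] by blast
  \<comment> \<open>Row \<open>0\<close> is unconstrained, so the sequences start at row \<open>1\<close>.\<close>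
  interpret kolmogorov_approximation "\<lambda>n. ?P (Suc n)" "\<lambda>n. ?a (Suc n)" "\<lambda>n. ?K (Suc n)" B
  proof (rule kolmogorov_approximation.intro)
    fix n :: nat and u r :: real
    have n: "Suc n \<ge> 1" by simp
    show "real_distribution (?P (Suc n))" by (rule real_distribution_row_sum_law[OF arr n])
    show "bounded_df (?K (Suc n))" "(?K (Suc n) \<longlongrightarrow> 0) at_bot"
      by (rule row_df_properties[OF arr n])+
    show "measure (interval_measure (?K (Suc n))) UNIV \<le> B"
      using row_df_properties(3)[OF arr n] B[OF n] by simp
    show "measure (?P (Suc n)) {x. r \<le> \<bar>x - ?a (Suc n)\<bar>} \<le> B / r\<^sup>2" if "r > 0"
      using row_sum_law_Chebyshev[OF arr n that] divide_right_mono[OF B[OF n], of "r\<^sup>2"] by simp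
    show "(\<lambda>n. char (?P (Suc n)) u -
        exp (\<i> * complex_of_real (u * ?a (Suc n)) + kolmogorov_exponent (?K (Suc n)) u)) \<longlonglongrightarrow> 0"
      using row_sum_char_asymptotics[OF arr assms(3) B, of u] by (rule LIMSEQ_Suc)
  qed
  have conv_m: "weak_conv_m (\<lambda>n. ?P (Suc n)) N \<longleftrightarrow> weak_conv_m ?P N" for N
    unfolding weak_conv_m_def by (rule weak_conv_Suc_iff)
  have mass: "(\<lambda>n. measure (interval_measure (?K (Suc n))) UNIV) \<longlonglongrightarrow> measure (interval_measure K) UNIV"
      "(\<lambda>n. measure (interval_measure (?K n)) UNIV) \<longlonglongrightarrow> measure (interval_measure K) UNIV"
    if "VCH M X kn c" "prob_space.variance (kolmogorov_law K) (\<lambda>y. y) = c" "bounded_df K"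
      "real_distribution (kolmogorov_law K)"
      "\<And>u. char (kolmogorov_law K) u = exp (kolmogorov_exponent K u)" for c K
  proof -
    have "measure (interval_measure K) UNIV = c"
      using that by (intro measure_eq_variance_kolmogorov_law) (auto simp: VCH_def)
    then show *: "(\<lambda>n. measure (interval_measure (?K (Suc n))) UNIV) \<longlonglongrightarrow> measure (interval_measure K) UNIV"
      using that(1) row_df_properties(3)[OF arr] by (simp add: VCH_def LIMSEQ_Suc)
    show "(\<lambda>n. measure (interval_measure (?K n)) UNIV) \<longlonglongrightarrow> measure (interval_measure K) UNIV"
      using * by (rule LIMSEQ_imp_Suc)
  qed
  show ?thesis
  proof (intro conjI allI impI; elim conjE)
    fix K \<alpha> assume K: "bounded_df K" "weak_conv ?K K" and a: "?a \<longlonglongrightarrow> \<alpha>"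
    note law = weak_conv_kolmogorov_law[OF K(1) iffD2[OF weak_conv_Suc_iff K(2)] LIMSEQ_Suc[OF a]]
    show "weak_conv_m ?P (shift_law (kolmogorov_law K) \<alpha>)"
      using law(1) by (simp add: conv_m)
    fix c assume "VCH M X kn c" "prob_space.variance (kolmogorov_law K) (\<lambda>y. y) = c"
    from mass(2)[OF this K(1) law(2,3)] K(2)
    show "df_weak_conv ?K K" by (simp add: df_weak_conv_def)
  next
    fix N assume N: "real_distribution N" "weak_conv_m ?P N"
    obtain \<alpha> K where a: "(\<lambda>n. ?a (Suc n)) \<longlonglongrightarrow> \<alpha>" and K: "bounded_df K"
      and law: "N = shift_law (kolmogorov_law K) \<alpha>" "real_distribution (kolmogorov_law K)"
        "\<And>u. char (kolmogorov_law K) u = exp (kolmogorov_exponent K u)"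
      and const: "\<exists>b. weak_conv (\<lambda>n x. ?K (Suc n) x - b n) K"
      and point: "\<And>x. isCont K x \<Longrightarrow> convergent (\<lambda>n. ?K (Suc n) x) \<Longrightarrow> weak_conv (\<lambda>n. ?K (Suc n)) K"
      and full: "(\<lambda>n. measure (interval_measure (?K (Suc n))) UNIV) \<longlonglongrightarrow> measure (interval_measure K) UNIV
        \<Longrightarrow> weak_conv (\<lambda>n. ?K (Suc n)) K"
      using kolmogorov_representation_of_limit[OF N(1) iffD2[OF conv_m N(2)]] by blast
    show "\<exists>a. ?a \<longlonglongrightarrow> a \<and> (\<exists>K. bounded_df K \<and> N = shift_law (kolmogorov_law K) a \<and>
             (\<exists>b. weak_conv (\<lambda>n x. ?K n x - b n) K) \<and>
             ((\<exists>x. isCont K x \<and> convergent (\<lambda>n. ?K n x)) \<longrightarrow> weak_conv ?K K) \<and>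
             (\<forall>c. VCH M X kn c \<and> prob_space.variance (kolmogorov_law K) (\<lambda>y. y) = c \<longrightarrow>
                df_weak_conv ?K K))"
    proof (intro exI[of _ \<alpha>] exI[of _ K] conjI allI impI; (elim exE conjE)?)
      show "?a \<longlonglongrightarrow> \<alpha>" using a by (rule LIMSEQ_imp_Suc)
      show "bounded_df K" by (rule K)
      show "N = shift_law (kolmogorov_law K) \<alpha>" by (rule law)
      obtain b where "weak_conv (\<lambda>n x. ?K (Suc n) x - b n) K" using const by blast
      then show "\<exists>b. weak_conv (\<lambda>n x. ?K n x - b n) K"
        \<comment> \<open>The constants \<open>b\<close> belong to the sequence that starts at row \<open>1\<close>, hence the shift of their index.\<close>
        using weak_conv_Suc_iff[of "\<lambda>n x. ?K n x - b (n - 1)" K] by auto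
    next
      fix x assume "isCont K x" "convergent (\<lambda>n. ?K n x)"
      then have "weak_conv (\<lambda>n. ?K (Suc n)) K"
        using convergent_Suc_iff[of "\<lambda>n. ?K n x"] by (intro point) auto
      then show "weak_conv ?K K" by (simp only: weak_conv_Suc_iff)
    next
      fix c assume c: "VCH M X kn c" "prob_space.variance (kolmogorov_law K) (\<lambda>y. y) = c"
      have "weak_conv (\<lambda>n. ?K (Suc n)) K"
        using c K law(2,3) by (intro full mass(1))
      moreover have "(\<lambda>n. measure (interval_measure (?K n)) UNIV) \<longlonglongrightarrow> measure (interval_measure K) UNIV"
        using c K law(2,3) by (rule mass(2))
      ultimately show "df_weak_conv ?K K" by (simp add: df_weak_conv_def weak_conv_Suc_iff)
    qed
  qed
qed

end
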